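(* Let $0<\lambda<1/e$, $E(z)=\lambda e^z$, and let $s>1$. Let $h(t)=t/(\log(1/t))^s$ (defined for small $t>0$). Then $\mathcal H^h(\mathcal J(E)\setminus\mathcal C)=0$.
   Context: For $0<\lambda<1/e$ the function $E(z)=\lambda e^z$ has two real fixed points $\alpha<1<\beta$, with $\alpha$ attracting and $\beta$ repelling. The Fatou set $\mathcal F(E)$ is the set of points where the iterates $E^n$ form a normal family, and the Julia set is $\mathcal J(E)=\mathbb C\setminus\mathcal F(E)$. By a theorem of Devaney and Krych, $\mathcal F(E)$ is the attracting basin of $\alpha$ and $\mathcal J(E)$ is a union of uncountably many pairwise disjoint curves ("hairs"), each connecting a point of $\mathbb C$ (the endpoint of the hair) with $\infty$; each hair is the set of points of $\mathcal J(E)$ sharing a given itinerary, where the itinerary of $z$ is the sequence $(s_j)$ with $(2s_j-1)\pi\le \operatorname{Im}E^j(z)<(2s_j+1)\pi$. $\mathcal C$ denotes the set of endpoints of these hairs. For a gauge function $h$ (an increasing continuous $h:(0,t_0)\to(0,\infty)$ with $h(t)\to0$ as $t\to0$) and $A\subset\mathbb R^m$, $\mathcal H^h(A)=\lim_{\delta\to0}\inf\{\sum_k h(\operatorname{diam}A_k)\}$, the infimum over all countable covers $(A_k)$ of $A$ with $\operatorname{diam}A_k<\delta$. *)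

theory Defs
  imports "HOL-Analysis.Analysis"
begin

definition expmap :: "real \<Rightarrow> complex \<Rightarrow> complex" where
  "expmap lam z = complex_of_real lam * exp z"

text \<open>Normality of the family of iterates of f at the point z: there is an open
  neighbourhood U of z such that every subsequence of (f^n) has a further
  subsequence converging locally uniformly on U, either to a (finite) limit
  function or to infinity (i.e. convergence in the spherical metric).\<close>
definition normal_at :: "(complex \<Rightarrow> complex) \<Rightarrow> complex \<Rightarrow> bool" where
  "normal_at f z \<longleftrightarrow>
     (\<exists>U. open U \<and> z \<in> U \<and>
        (\<forall>r::nat\<Rightarrow>nat. strict_mono r \<longrightarrow>
           (\<exists>q::nat\<Rightarrow>nat. strict_mono q \<and>
              ((\<exists>g. \<forall>K. compact K \<and> K \<subseteq> U \<longrightarrow>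
                   uniform_limit K (\<lambda>n. (f ^^ (r (q n)))) g sequentially)
               \<or> (\<forall>K. compact K \<and> K \<subseteq> U \<longrightarrow>
                   (\<forall>M. eventually (\<lambda>n. \<forall>x\<in>K. norm ((f ^^ (r (q n))) x) \<ge> M) sequentially))))))"

definition fatou_set :: "(complex \<Rightarrow> complex) \<Rightarrow> complex set" where
  "fatou_set f = {z. normal_at f z}"

definition julia_set :: "(complex \<Rightarrow> complex) \<Rightarrow> complex set" where
  "julia_set f = UNIV - fatou_set f"

text \<open>Itinerary: s_j with (2 s_j - 1) pi \<le> Im f^j(z) < (2 s_j + 1) pi.\<close>
definition itinerary :: "(complex \<Rightarrow> complex) \<Rightarrow> complex \<Rightarrow> nat \<Rightarrow> int" where
  "itinerary f z j = floor ((Im ((f ^^ j) z) + pi) / (2 * pi))"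

definition hair :: "(complex \<Rightarrow> complex) \<Rightarrow> (nat \<Rightarrow> int) \<Rightarrow> complex set" where
  "hair f s = {z \<in> julia_set f. itinerary f z = s}"

definition endpoints :: "(complex \<Rightarrow> complex) \<Rightarrow> complex set" where
  "endpoints f = {\<gamma> 0 | \<gamma> s. continuous_on {0..} \<gamma> \<and> inj_on \<gamma> {0..} \<and>
                     \<gamma> ` {0..} = hair f s \<and>
                     filterlim (\<lambda>t. norm (\<gamma> (t::real))) at_top at_top}"

definition hausdorff_gauge :: "(real \<Rightarrow> real) \<Rightarrow> complex set \<Rightarrow> ennreal" where
  "hausdorff_gauge h A =
     (SUP \<delta>\<in>{0<..}. INF C\<in>{C :: nat \<Rightarrow> complex set. A \<subseteq> (\<Union>k. C k) \<and>
                         (\<forall>k. bounded (C k) \<and> diameter (C k) < \<delta>)}.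
                  (\<Sum>k. ennreal (h (diameter (C k)))))"

end

theory Submission
  imports Defs "HOL-Complex_Analysis.Complex_Analysis" "HOL-Real_Asymp.Real_Asymp"
begin

text \<open>
  Put \<open>B = -ln \<lambda> > 1\<close>, so that \<open>E z = exp (z - B)\<close>. The Julia set is the set \<open>X\<close> of points whose orbit
  stays in the half-plane \<open>Re \<ge> B\<close>: outside \<open>X\<close> the orbits enter a disc on which \<open>E\<close> contracts,
  while on \<open>X\<close> the derivatives of the iterates grow like \<open>B^n\<close>.

  Two points of \<open>X\<close> with the same itinerary have imaginary parts at distance less than \<open>pi\<close> along their
  orbits, while their orbits move apart exponentially; hence their real parts separate, which orders
  every hair linearly. From a minimal point \<open>z\<close> of a hair one obtains a parametrisation of the whole
  hair by pulling back the points \<open>E^n z + \<tau>_n(t)\<close> with \<open>\<tau>_n(t)\<close> real, so \<open>z\<close> is an endpoint.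

  If \<open>z\<close> is not minimal, comparison with a smaller point shows that eventually
  \<open>|Im z_n| \<le> Re z_n\<close> and \<open>|Im z_(n+1)| \<le> exp (Re z_n / 2)\<close>. A unit box at real part \<open>a\<close> is mapped by \<open>E\<close>
  to size about \<open>R = exp (a - B)\<close>, and its points of this kind land in a strip of height
  about \<open>sqrt R\<close>. Covering that strip by squares of the size of its height bounds the gauge sum by a
  multiple of \<open>a^(-s)\<close>. Covering the image instead by \<open>O(R^2)\<close> unit boxes, each pulled back
  with contraction \<open>O(1/R)\<close>, improves a bound \<open>c a^(-s)\<close> to \<open>O(c R^(1-s))\<close>, which is at most
  \<open>c a^(-s) / 2\<close> for large \<open>a\<close> because \<open>s > 1\<close>. Iteration gives measure zero.
\<close>

section \<open>Hausdorff contents for logarithmic gauges\<close>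

definition log_gauge :: "real \<Rightarrow> real \<Rightarrow> real" where
  "log_gauge s t = t / (ln (1 / t)) powr s"

text \<open>The inner infimum of \<open>hausdorff_gauge\<close> at one fixed scale. It is kept apart
  from the supremum because contractions change the scale and the value together.\<close>

definition gauge_content :: "real \<Rightarrow> real \<Rightarrow> complex set \<Rightarrow> ennreal" where
  "gauge_content s \<delta> A = (INF C\<in>{C :: nat \<Rightarrow> complex set. A \<subseteq> (\<Union>k. C k) \<and>
                         (\<forall>k. bounded (C k) \<and> diameter (C k) < \<delta>)}.
                  (\<Sum>k. ennreal (log_gauge s (diameter (C k)))))"

lemma hausdorff_gauge_log_gauge:
  "hausdorff_gauge (\<lambda>t. t / (ln (1 / t)) powr s) A = (SUP \<delta>\<in>{0<..}. gauge_content s \<delta> A)"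
  by (simp add: hausdorff_gauge_def gauge_content_def log_gauge_def)

lemma log_gauge_0 [simp]: "log_gauge s 0 = 0"
  by (simp add: log_gauge_def)

text \<open>\<open>ln (1 / t)\<close> grows as \<open>t\<close> shrinks, so the denominator only
  helps and at least the factor \<open>c\<close> is gained. The case \<open>c = 1\<close> is
  monotonicity.\<close>

lemma log_gauge_scale:
  assumes "0 \<le> u" "u \<le> c * t" "0 < c" "c \<le> 1" "t < 1" "0 \<le> s"
  shows "log_gauge s u \<le> c * log_gauge s t"
proof (cases "u = 0")
  case True
  have "0 \<le> c * t" using assms by simp
  then have "0 \<le> t" using assms by (simp add: zero_le_mult_iff)
  then show ?thesis using True assms by (simp add: log_gauge_def)
next
  case False
  then have u: "u > 0" using assms by simp
  then have "0 < c * t" using assms by linarith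
  then have t: "0 < t" using assms by (simp add: zero_less_mult_iff)
  have "c * t \<le> t" using assms t by simp
  then have ut: "u \<le> t" using assms by simp
  have "ln (1 / t) \<le> ln (1 / u)" using u t ut by (simp add: frac_le)
  moreover have "0 < ln (1 / t)" using t assms by simp
  ultimately have "ln (1 / t) powr s \<le> ln (1 / u) powr s" "0 < ln (1 / t) powr s"
    using assms by (auto intro: powr_mono2)
  then have "u / ln (1 / u) powr s \<le> (c * t) / ln (1 / t) powr s"
    using assms u by (intro frac_le) auto
  then show ?thesis by (simp add: log_gauge_def)
qed

section \<open>Monotonicity and countable subadditivity of the content\<close>

lemma gauge_content_le:
  assumes "A \<subseteq> (\<Union>k. C k)" "\<And>k. bounded (C k)" "\<And>k. diameter (C k) < \<delta>"
  shows "gauge_content s \<delta> A \<le> (\<Sum>k. ennreal (log_gauge s (diameter (C k))))"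
  unfolding gauge_content_def by (rule INF_lower) (use assms in auto)

lemma gauge_content_mono:
  assumes "A \<subseteq> A'" "\<delta>' \<le> \<delta>"
  shows "gauge_content s \<delta> A \<le> gauge_content s \<delta>' A'"
  unfolding gauge_content_def by (rule INF_superset_mono) (use assms in \<open>auto 0 3 intro: less_le_trans\<close>)

lemma gauge_content_approx:
  assumes "gauge_content s \<delta> A < x"
  obtains C where "A \<subseteq> (\<Union>k. C k)" "\<And>k. bounded (C k)" "\<And>k. diameter (C k) < \<delta>"
    "(\<Sum>k. ennreal (log_gauge s (diameter (C k)))) < x"
  using assms unfolding gauge_content_def INF_less_iff by auto

lemma gauge_content_single:
  assumes "bounded A" "diameter A \<le> t" "t < \<delta>" "t < 1" "0 \<le> s"
  shows "gauge_content s \<delta> A \<le> ennreal (log_gauge s t)"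
proof -
  define C where "C k = (if k = (0::nat) then A else {})" for k
  have 0: "0 \<le> diameter A" using assms by (simp add: diameter_ge_0)
  have "gauge_content s \<delta> A \<le> (\<Sum>k. ennreal (log_gauge s (diameter (C k))))"
    by (rule gauge_content_le) (use assms 0 in \<open>auto simp: C_def split: if_splits\<close>)
  also have "\<dots> = (\<Sum>k\<in>{0}. ennreal (log_gauge s (diameter (C k))))"
    by (rule suminf_finite) (auto simp: C_def)
  also have "\<dots> = ennreal (log_gauge s (diameter A))" by (simp add: C_def)
  also have "\<dots> \<le> ennreal (log_gauge s t)"
    using log_gauge_scale[of "diameter A" 1 t s] assms 0 by (intro ennreal_leI) auto
  finally show ?thesis .
qed

lemma gauge_content_empty [simp]:
  assumes "0 < \<delta>" shows "gauge_content s \<delta> {} = 0"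
  using gauge_content_le[of "{}" "\<lambda>_. {}" \<delta> s] assms by simp

text \<open>Near-optimal covers of the \<open>S i\<close>, with errors \<open>e / 2^(i+1)\<close>,
  are merged into one sequence through the pairing function on the naturals.\<close>

lemma gauge_content_UN:
  "gauge_content s \<delta> (\<Union>i. S i) \<le> (\<Sum>i. gauge_content s \<delta> (S i))" for S :: "nat \<Rightarrow> complex set"
proof (rule ennreal_le_epsilon)
  fix e :: real assume fin: "(\<Sum>i. gauge_content s \<delta> (S i)) < top" and e: "0 < e"
  \<comment> \<open>Finiteness makes adding a positive error strict, so a cover within that error
    exists.\<close>
  have fini: "gauge_content s \<delta> (S i) < top" for i
  proof -
    have "gauge_content s \<delta> (S i) = (\<Sum>i\<in>{i}. gauge_content s \<delta> (S i))" by simp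
    also have "\<dots> \<le> (\<Sum>i. gauge_content s \<delta> (S i))" by (rule sum_le_suminf) auto
    finally show ?thesis using fin by simp
  qed
  have "\<exists>C. S i \<subseteq> (\<Union>k. C k) \<and> (\<forall>k. bounded (C k) \<and> diameter (C k) < \<delta>) \<and>
     (\<Sum>k. ennreal (log_gauge s (diameter (C k)))) \<le> gauge_content s \<delta> (S i) + ennreal (e * (1/2)^Suc i)" for i
  proof -
    have "gauge_content s \<delta> (S i) < gauge_content s \<delta> (S i) + ennreal (e * (1/2)^Suc i)"
      using fini[of i] e by (auto simp: ennreal_add_left_cancel_less intro!: ennreal_less_top)
    then show ?thesis
      by (rule gauge_content_approx) (metis order.strict_implies_order)
  qed
  then obtain C where C: "\<And>i. S i \<subseteq> (\<Union>k. C i k)" "\<And>i k. bounded (C i k)" "\<And>i k. diameter (C i k) < \<delta>"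
     "\<And>i. (\<Sum>k. ennreal (log_gauge s (diameter (C i k)))) \<le> gauge_content s \<delta> (S i) + ennreal (e * (1/2)^Suc i)"
    by metis
  define D where "D n = (case prod_decode n of (i, k) \<Rightarrow> C i k)" for n
  have "(\<Union>i. S i) \<subseteq> (\<Union>n. D n)"
  proof
    fix x assume "x \<in> (\<Union>i. S i)"
    then obtain i k where "x \<in> C i k" using C(1) by blast
    then have "x \<in> D (prod_encode (i, k))" by (simp add: D_def)
    then show "x \<in> (\<Union>n. D n)" by blast
  qed
  then have "gauge_content s \<delta> (\<Union>i. S i) \<le> (\<Sum>n. ennreal (log_gauge s (diameter (D n))))"
    by (rule gauge_content_le) (auto simp: D_def C split: prod.split)
  also have "\<dots> = (\<Sum>n. (\<lambda>(i, k). ennreal (log_gauge s (diameter (C i k)))) (prod_decode n))"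
    by (simp add: D_def case_prod_beta)
  also have "\<dots> = (\<Sum>i. \<Sum>k. ennreal (log_gauge s (diameter (C i k))))"
    by (rule suminf_ennreal_2dimen) simp
  also have "\<dots> \<le> (\<Sum>i. gauge_content s \<delta> (S i) + ennreal (e * (1/2)^Suc i))"
    by (rule suminf_le[OF C(4)]) auto
  also have "\<dots> = (\<Sum>i. gauge_content s \<delta> (S i)) + (\<Sum>i. ennreal (e * (1/2)^Suc i))"
    by (rule suminf_add[symmetric]) auto
  also have "(\<Sum>i. ennreal (e * (1/2)^Suc i)) = ennreal e"
  proof (rule suminf_ennreal_eq)
    show "(\<lambda>i. e * (1/2)^Suc i) sums e" using sums_mult[OF power_half_series, of e] by simp
  qed (use e in auto)
  finally show "gauge_content s \<delta> (\<Union>i. S i) \<le> (\<Sum>i. gauge_content s \<delta> (S i)) + ennreal e" .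
qed

lemma gauge_content_countable_UN_eq_0:
  assumes "countable I" "0 < \<delta>" "\<And>i. i \<in> I \<Longrightarrow> gauge_content s \<delta> (S i) = 0"
  shows "gauge_content s \<delta> (\<Union>i\<in>I. S i) = 0"
proof (cases "I = {}")
  case False
  have "(\<Union>i\<in>I. S i) = (\<Union>n. S (from_nat_into I n))"
    using range_from_nat_into[OF False assms(1)] by (metis image_image)
  moreover have "gauge_content s \<delta> (S (from_nat_into I n)) = 0" for n
    using assms(3) from_nat_into[OF False] by auto
  ultimately show ?thesis using gauge_content_UN[of s \<delta> "\<lambda>n. S (from_nat_into I n)"] by simp
qed (use assms in auto)

lemma gauge_content_finite_UN:
  assumes "finite I" "0 < \<delta>"
  shows "gauge_content s \<delta> (\<Union>i\<in>I. S i) \<le> (\<Sum>i\<in>I. gauge_content s \<delta> (S i))"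
  using assms(1)
proof (induction I rule: finite_induct)
  case (insert x F)
  define D where "D n = (if n = (0::nat) then S x else if n = 1 then \<Union>i\<in>F. S i else {})" for n
  have "(\<Union>i\<in>insert x F. S i) \<subseteq> (\<Union>n. D n)"
  proof
    fix y assume "y \<in> (\<Union>i\<in>insert x F. S i)"
    then have "y \<in> D 0 \<or> y \<in> D 1" by (auto simp: D_def)
    then show "y \<in> (\<Union>n. D n)" by blast
  qed
  then have "gauge_content s \<delta> (\<Union>i\<in>insert x F. S i) \<le> gauge_content s \<delta> (\<Union>n. D n)"
    by (rule gauge_content_mono) simp
  also have "\<dots> \<le> (\<Sum>n. gauge_content s \<delta> (D n))" by (rule gauge_content_UN)
  also have "\<dots> = (\<Sum>n\<in>{0, 1}. gauge_content s \<delta> (D n))"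
    by (rule suminf_finite) (use assms in \<open>auto simp: D_def\<close>)
  also have "\<dots> = gauge_content s \<delta> (S x) + gauge_content s \<delta> (\<Union>i\<in>F. S i)" by (simp add: D_def)
  also have "\<dots> \<le> (\<Sum>i\<in>insert x F. gauge_content s \<delta> (S i))"
    using insert by (simp add: add_left_mono)
  finally show ?case .
qed (use assms in auto)

section \<open>Behaviour under contractions\<close>

lemma bounded_diameter_lipschitz_image:
  fixes g :: "complex \<Rightarrow> complex"
  assumes "bounded S" "\<And>x y. x \<in> S \<Longrightarrow> y \<in> S \<Longrightarrow> dist (g x) (g y) \<le> c * dist x y" "0 \<le> c"
  shows "bounded (g ` S)" "diameter (g ` S) \<le> c * diameter S"
proof -
  have *: "dist (g x) (g y) \<le> c * diameter S" if "x \<in> S" "y \<in> S" for x y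
    using assms(2)[OF that] diameter_bounded_bound[OF assms(1) that] assms(3)
    by (meson mult_left_mono order_trans)
  then show "bounded (g ` S)" unfolding bounded_two_points by blast
  show "diameter (g ` S) \<le> c * diameter S"
    by (rule diameter_le) (use * assms diameter_ge_0[OF assms(1)] in \<open>auto simp: dist_norm\<close>)
qed

text \<open>Images of covering sets have diameters smaller by the factor \<open>c\<close>, and by
  \<open>log_gauge_scale\<close> so are their gauge values. Both the scale and the content therefore
  gain \<open>c\<close>.\<close>

lemma gauge_content_lipschitz_image:
  fixes g :: "complex \<Rightarrow> complex"
  assumes "\<And>x y. x \<in> S \<Longrightarrow> y \<in> S \<Longrightarrow> dist (g x) (g y) \<le> c * dist x y"
    and "0 < c" "c \<le> 1" "\<delta> \<le> 1" "0 \<le> s"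
  shows "gauge_content s (c * \<delta>) (g ` S) \<le> ennreal c * gauge_content s \<delta> S"
proof -
  have "gauge_content s (c * \<delta>) (g ` S) \<le> (\<Sum>k. ennreal (log_gauge s (diameter (C k)))) * ennreal c"
    if C: "S \<subseteq> (\<Union>k. C k)" "\<And>k. bounded (C k)" "\<And>k. diameter (C k) < \<delta>" for C :: "nat \<Rightarrow> complex set"
  proof -
    define D where "D k = g ` (C k \<inter> S)" for k
    have b: "bounded (C k \<inter> S)" for k using C(2) by blast
    have dk: "diameter (D k) \<le> c * diameter (C k)" "bounded (D k)" for k
    proof -
      have "diameter (D k) \<le> c * diameter (C k \<inter> S)"
        unfolding D_def by (rule bounded_diameter_lipschitz_image[OF b]) (use assms in auto)
      also have "\<dots> \<le> c * diameter (C k)"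
        using assms C by (intro mult_left_mono diameter_subset) auto
      finally show "diameter (D k) \<le> c * diameter (C k)" .
      show "bounded (D k)"
        unfolding D_def by (rule bounded_diameter_lipschitz_image(1)[OF b, where c = c]) (use assms in auto)
    qed
    have "c * diameter (C k) < c * \<delta>" for k using C(3) assms by simp
    then have "gauge_content s (c * \<delta>) (g ` S) \<le> (\<Sum>k. ennreal (log_gauge s (diameter (D k))))"
      by (intro gauge_content_le) (use C dk in \<open>fastforce simp: D_def intro: le_less_trans\<close>)+
    also have "\<dots> \<le> (\<Sum>k. ennreal (log_gauge s (diameter (C k))) * ennreal c)"
    proof (rule suminf_le)
      fix k
      have "log_gauge s (diameter (D k)) \<le> c * log_gauge s (diameter (C k))"
        by (rule log_gauge_scale)
          (use dk assms C(3)[of k] diameter_ge_0[OF dk(2)[of k]] in auto)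
      then show "ennreal (log_gauge s (diameter (D k))) \<le> ennreal (log_gauge s (diameter (C k))) * ennreal c"
        using assms by (subst ennreal_mult''[symmetric]) (auto intro!: ennreal_leI simp: mult.commute)
    qed auto
    also have "\<dots> = (\<Sum>k. ennreal (log_gauge s (diameter (C k)))) * ennreal c"
      by (rule ennreal_suminf_multc)
    finally show ?thesis .
  qed
  note * = this
  \<comment> \<open>Dividing by \<open>c\<close> turns the estimate for single covers into a lower
    bound for the infimum.\<close>
  have "gauge_content s (c * \<delta>) (g ` S) / ennreal c \<le> gauge_content s \<delta> S"
    unfolding gauge_content_def[of s \<delta> S]
  proof (rule INF_greatest)
    fix C :: "nat \<Rightarrow> complex set"
    assume "C \<in> {C. S \<subseteq> (\<Union>k. C k) \<and> (\<forall>k. bounded (C k) \<and> diameter (C k) < \<delta>)}"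
    then show "gauge_content s (c * \<delta>) (g ` S) / ennreal c \<le> (\<Sum>k. ennreal (log_gauge s (diameter (C k))))"
      using assms(2) *[of C] by (intro divide_le_posI_ennreal) (auto simp: mult.commute)
  qed
  then have "ennreal c * (gauge_content s (c * \<delta>) (g ` S) / ennreal c) \<le> ennreal c * gauge_content s \<delta> S"
    by (rule mult_left_mono) simp
  then show ?thesis using assms(2)
    by (simp add: ennreal_times_divide ennreal_mult_divide_eq mult.commute[of "ennreal c" "gauge_content s (c * \<delta>) (g ` S)"])
qed

section \<open>The Julia set\<close>

locale exp_family =
  fixes lam :: real
  assumes lam_pos: "0 < lam" and lam_less: "lam < 1 / exp 1"
begin

abbreviation E :: "complex \<Rightarrow> complex" where
  "E \<equiv> expmap lam"

definition B :: real where
  "B = - ln lam"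

lemma B_gt_1: "1 < B"
proof -
  have "ln lam < ln (1 / exp 1)" using lam_pos lam_less by (subst ln_less_cancel_iff) auto
  then show ?thesis by (simp add: B_def ln_div)
qed

lemma B_power_at_top: "filterlim (\<lambda>n. B ^ n) at_top sequentially"
  using B_gt_1 by real_asymp

lemma E_eq_exp: "E z = exp (z - of_real B)"
proof -
  have "exp (- of_real B :: complex) = of_real (exp (- B))"
    by (simp only: exp_of_real flip: of_real_minus)
  also have "exp (- B) = lam" using lam_pos by (simp add: B_def)
  finally show ?thesis by (simp add: expmap_def exp_diff exp_minus field_simps)
qed

lemma norm_E: "norm (E z) = exp (Re z - B)"
  by (simp add: E_eq_exp)

lemma E_derivative: "(E has_field_derivative E z) (at z within S)"
  unfolding E_eq_exp[abs_def] by (auto intro!: derivative_eq_intros)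

lemma holomorphic_E_iter: "(E ^^ n) holomorphic_on S"
proof (induction n)
  case (Suc n)
  have "(\<lambda>z. exp ((E ^^ n) z - of_real B)) holomorphic_on S"
    using Suc by (intro holomorphic_intros)
  also have "(\<lambda>z. exp ((E ^^ n) z - of_real B)) = E ^^ Suc n"
    by (rule ext) (simp add: E_eq_exp)
  finally show ?case .
qed (auto simp: id_def intro: holomorphic_intros)

lemma continuous_on_E_iter: "continuous_on S (E ^^ n)"
  by (rule holomorphic_on_imp_continuous_on[OF holomorphic_E_iter])

lemma deriv_E_iter: "((E ^^ n) has_field_derivative (\<Prod>k<n. (E ^^ Suc k) z)) (at z)"
proof (induction n)
  case (Suc n)
  have "((\<lambda>z. E ((E ^^ n) z)) has_field_derivative (E ((E ^^ n) z) * (\<Prod>k<n. (E ^^ Suc k) z))) (at z)"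
    by (rule DERIV_chain2[OF E_derivative Suc])
  then show ?case by (simp add: comp_def mult.commute)
qed (auto simp: id_def)

definition X :: "complex set" where
  "X = {z. \<forall>n. B \<le> Re ((E ^^ n) z)}"

lemma X_Re_ge: "z \<in> X \<Longrightarrow> B \<le> Re ((E ^^ n) z)"
  by (simp add: X_def)

lemma X_Re_ge0: "z \<in> X \<Longrightarrow> B \<le> Re z"
  using X_Re_ge[of z 0] by simp

lemma X_iter: "z \<in> X \<Longrightarrow> (E ^^ n) z \<in> X"
  by (simp add: X_def flip: funpow_add comp_apply[of "E ^^ _" "E ^^ n"])

lemma X_E: "z \<in> X \<Longrightarrow> E z \<in> X"
  using X_iter[of z 1] by simp

lemma X_iff_E: "z \<in> X \<longleftrightarrow> B \<le> Re z \<and> E z \<in> X"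
proof
  assume *: "B \<le> Re z \<and> E z \<in> X"
  have "B \<le> Re ((E ^^ n) z)" for n
    using * by (cases n) (auto simp: X_def funpow_swap1 simp del: funpow.simps simp: funpow_Suc_right)
  then show "z \<in> X" by (simp add: X_def)
qed (auto simp: X_E X_Re_ge0)

text \<open>Since \<open>E\<close> is its own derivative, the chain rule gives the product of the
  next \<open>n\<close> orbit points, each of modulus at least its real part, hence at least
  \<open>B\<close>.\<close>

lemma norm_deriv_E_iter_ge:
  assumes "z \<in> X" shows "B ^ n \<le> norm (deriv (E ^^ n) z)"
proof -
  have "B \<le> norm ((E ^^ k) z)" for k
    using X_Re_ge[OF assms, of k] complex_Re_le_cmod[of "(E ^^ k) z"] by linarith
  then have "(\<Prod>k<n. B) \<le> (\<Prod>k<n. norm ((E ^^ Suc k) z))"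
    using B_gt_1 by (intro prod_mono conjI) (auto simp del: funpow.simps)
  then show ?thesis using DERIV_imp_deriv[OF deriv_E_iter[of n z]] by (simp add: prod_norm)
qed

section \<open>Normality off \<open>X\<close> and its failure on \<open>X\<close>\<close>

lemma norm_E_less_1:
  assumes "Re z < B" shows "norm (E z) < 1"
  using assms by (simp add: norm_E)

text \<open>Leaving the half-plane sends the next point into the unit disc, which itself lies in
  \<open>Re z < B\<close> because \<open>B > 1\<close>; the orbit is trapped there.\<close>

lemma norm_E_iter_less_1:
  assumes "Re ((E ^^ n) z) < B" "n < m" shows "norm ((E ^^ m) z) < 1"
  using assms(2)
proof (induction m)
  case (Suc m)
  have "Re ((E ^^ m) z) < B"
  proof (cases "m = n")
    case False
    then have "norm ((E ^^ m) z) < 1" using Suc by simp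
    then show ?thesis using complex_Re_le_cmod[of "(E ^^ m) z"] B_gt_1 by linarith
  qed (use assms in simp)
  then show ?case by (simp add: norm_E_less_1)
qed simp

text \<open>The intermediate value theorem for \<open>a - exp (a - B)\<close> on
  \<open>[0, 1]\<close>; the point found is the attracting fixed point.\<close>

lemma fixed_point: "\<exists>a. 0 \<le> a \<and> a \<le> 1 \<and> E (of_real a) = of_real a"
proof -
  have "\<exists>a\<ge>0. a \<le> 1 \<and> a - exp (a - B) = 0"
  proof (rule IVT')
    show "0 - exp (0 - B) \<le> 0" "0 \<le> 1 - exp (1 - B)" using B_gt_1 by auto
  qed (auto intro!: continuous_intros)
  then obtain a where a: "0 \<le> a" "a \<le> 1" "exp (a - B) = a" by auto
  have "E (of_real a) = of_real (exp (a - B))" by (simp add: E_eq_exp exp_of_real flip: of_real_diff)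
  then show ?thesis using a by auto
qed

lemma E_contraction:
  assumes "Re z \<le> 1" "Re w \<le> 1"
  shows "norm (E z - E w) \<le> exp (1 - B) * norm (z - w)"
proof (rule field_differentiable_bound[where S = "{z. Re z \<le> 1}"])
  show "convex {z. Re z \<le> 1}" by (rule convex_halfspace_Re_le)
qed (use assms in \<open>auto simp: norm_E intro: E_derivative\<close>)

text \<open>Near \<open>z\<close> all orbits enter the unit disc at a common time and are then
  contracted towards the fixed point, so the full sequence of iterates converges uniformly.\<close>

lemma not_X_imp_normal:
  assumes "z \<notin> X" shows "normal_at E z"
proof -
  obtain n where n: "Re ((E ^^ n) z) < B" using assms by (auto simp: X_def not_le)
  obtain a where a: "0 \<le> a" "a \<le> 1" "E (of_real a) = of_real a" using fixed_point by blast
  define U where "U = {z. Re ((E ^^ n) z) < B}"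
  have "open U"
    unfolding U_def
    by (intro open_Collect_less continuous_intros continuous_on_E_iter)
  \<comment> \<open>The factor 2 bounds the distance between two points of the closed unit
    disc.\<close>
  have bound: "norm ((E ^^ (Suc n + k)) w - of_real a) \<le> exp (1 - B) ^ k * 2" if "w \<in> U" for w k
  proof (induction k)
    case 0
    have "norm ((E ^^ Suc n) w) < 1" using norm_E_iter_less_1[of n w "Suc n"] that by (simp add: U_def)
    moreover have "norm (of_real a :: complex) \<le> 1" using a by simp
    ultimately show ?case using norm_triangle_ineq4[of "(E ^^ Suc n) w" "of_real a"] by simp
  next
    case (Suc k)
    have "norm ((E ^^ (Suc n + k)) w) < 1" using norm_E_iter_less_1[of n w "Suc n + k"] that by (simp add: U_def)
    then have "Re ((E ^^ (Suc n + k)) w) \<le> 1" using complex_Re_le_cmod[of "(E ^^ (Suc n + k)) w"] by linarith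
    then have "norm (E ((E ^^ (Suc n + k)) w) - E (of_real a)) \<le> exp (1 - B) * norm ((E ^^ (Suc n + k)) w - of_real a)"
      using a by (intro E_contraction) auto
    also have "\<dots> \<le> exp (1 - B) * (exp (1 - B) ^ k * 2)"
      using Suc by (intro mult_left_mono) auto
    finally show ?case using a by simp
  qed
  have unif: "uniform_limit U (\<lambda>k. E ^^ k) (\<lambda>_. of_real a) sequentially"
  proof (rule uniform_limitI)
    fix e :: real assume "e > 0"
    have "(\<lambda>k. exp (1 - B) ^ k * 2) \<longlonglongrightarrow> 0 * 2"
      using B_gt_1 by (intro tendsto_intros LIMSEQ_power_zero) auto
    from order_tendstoD(2)[OF this, of e] have "eventually (\<lambda>k. exp (1 - B) ^ k * 2 < e) sequentially"
      using \<open>e > 0\<close> by simp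
    then have "eventually (\<lambda>k. \<forall>w\<in>U. dist ((E ^^ (k + Suc n)) w) (of_real a) < e) sequentially"
    proof eventually_elim
      case (elim k)
      show ?case
      proof
        fix w assume "w \<in> U"
        from bound[OF this, of k] elim show "dist ((E ^^ (k + Suc n)) w) (of_real a) < e"
          by (simp only: dist_norm add.commute[of k])
      qed
    qed
    then show "eventually (\<lambda>k. \<forall>w\<in>U. dist ((E ^^ k) w) (of_real a) < e) sequentially"
      by (subst (asm) eventually_sequentially_seg)
  qed
  show ?thesis
    unfolding normal_at_def
  proof (intro exI[of _ U] conjI allI impI)
    show "z \<in> U" using n by (simp add: U_def)
    fix r :: "nat \<Rightarrow> nat" assume r: "strict_mono r"
    have "\<forall>K. compact K \<and> K \<subseteq> U \<longrightarrow> uniform_limit K (\<lambda>n. E ^^ r (id n)) (\<lambda>_. of_real a) sequentially"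
    proof (intro allI impI)
      fix K assume "compact K \<and> K \<subseteq> U"
      then have "uniform_limit K (\<lambda>k. E ^^ k) (\<lambda>_. of_real a) sequentially"
        using unif uniform_limit_on_subset by blast
      then show "uniform_limit K (\<lambda>n. E ^^ r (id n)) (\<lambda>_. of_real a) sequentially"
        unfolding id_apply by (rule filterlim_compose[OF _ filterlim_subseq[OF r]])
    qed
    then show "\<exists>q. strict_mono q \<and>
          ((\<exists>g. \<forall>K. compact K \<and> K \<subseteq> U \<longrightarrow> uniform_limit K (\<lambda>n. E ^^ r (q n)) g sequentially) \<or>
           (\<forall>K. compact K \<and> K \<subseteq> U \<longrightarrow> (\<forall>M. \<forall>\<^sub>F n in sequentially. \<forall>x\<in>K. M \<le> norm ((E ^^ r (q n)) x))))"
      by (intro exI[of _ id]) (auto simp: strict_mono_def)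
  qed fact
qed

text \<open>A finite limit would bound the derivatives at \<open>z\<close> by Cauchy's inequality,
  against their growth. Divergence to infinity fails because, by Bloch's theorem, iterates of a
  small disc cover a large one, which contains points that \<open>E\<close> sends to the negative
  real axis; their orbits then stay bounded.\<close>

lemma X_imp_not_normal:
  assumes z: "z \<in> X" shows "\<not> normal_at E z"
proof
  assume "normal_at E z"
  then obtain U where U: "open U" "z \<in> U" and
    ex: "\<And>r. strict_mono r \<Longrightarrow> (\<exists>q::nat\<Rightarrow>nat. strict_mono q \<and>
              ((\<exists>g. \<forall>K. compact K \<and> K \<subseteq> U \<longrightarrow>
                   uniform_limit K (\<lambda>n. (E ^^ (r (q n)))) g sequentially)
               \<or> (\<forall>K. compact K \<and> K \<subseteq> U \<longrightarrow>
                   (\<forall>M. eventually (\<lambda>n. \<forall>x\<in>K. norm ((E ^^ (r (q n))) x) \<ge> M) sequentially))))"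
    unfolding normal_at_def by blast
  obtain \<rho> where \<rho>: "\<rho> > 0" "cball z \<rho> \<subseteq> U" using U open_contains_cball by blast
  obtain q where q: "strict_mono q" and
    cases: "(\<exists>g. uniform_limit (cball z \<rho>) (\<lambda>n. E ^^ q n) g sequentially)
               \<or> (\<forall>M. eventually (\<lambda>n. \<forall>x\<in>cball z \<rho>. norm ((E ^^ q n) x) \<ge> M) sequentially)"
  proof -
    have id: "strict_mono (id :: nat \<Rightarrow> nat)" by (simp add: strict_mono_def)
    from ex[OF id] obtain q :: "nat \<Rightarrow> nat" where q: "strict_mono q" and
      *: "(\<exists>g. \<forall>K. compact K \<and> K \<subseteq> U \<longrightarrow> uniform_limit K (\<lambda>n. E ^^ q n) g sequentially)
       \<or> (\<forall>K. compact K \<and> K \<subseteq> U \<longrightarrow> (\<forall>M. eventually (\<lambda>n. \<forall>x\<in>K. norm ((E ^^ q n) x) \<ge> M) sequentially))"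
      by (auto simp only: id_apply)
    have K: "compact (cball z \<rho>) \<and> cball z \<rho> \<subseteq> U" using \<rho> by simp
    from * show thesis
    proof (elim disjE exE)
      fix g assume "\<forall>K. compact K \<and> K \<subseteq> U \<longrightarrow> uniform_limit K (\<lambda>n. E ^^ q n) g sequentially"
      from spec[OF this, of "cball z \<rho>"] K show thesis by (intro that[OF q] disjI1 exI[of _ g]) simp
    next
      assume "\<forall>K. compact K \<and> K \<subseteq> U \<longrightarrow> (\<forall>M. eventually (\<lambda>n. \<forall>x\<in>K. norm ((E ^^ q n) x) \<ge> M) sequentially)"
      from spec[OF this, of "cball z \<rho>"] K show thesis by (intro that[OF q] disjI2) simp
    qed
  qed
  have B_top: "filterlim (\<lambda>n. B ^ n) at_top sequentially"
    by (rule B_power_at_top)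
  from cases show False
  proof
    assume "\<exists>g. uniform_limit (cball z \<rho>) (\<lambda>n. E ^^ q n) g sequentially"
    then obtain g where g: "uniform_limit (cball z \<rho>) (\<lambda>n. E ^^ q n) g sequentially" by blast
    have "continuous_on (cball z \<rho>) g"
      by (rule uniform_limit_theorem[OF _ g]) (simp_all add: continuous_on_E_iter)
    then have "bounded (g ` cball z \<rho>)"
      by (intro compact_imp_bounded compact_continuous_image) auto
    then obtain M where M: "\<And>x. x \<in> cball z \<rho> \<Longrightarrow> norm (g x) \<le> M" by (metis bounded_iff imageI)
    have "eventually (\<lambda>n. \<forall>x\<in>cball z \<rho>. dist ((E ^^ q n) x) (g x) < 1) sequentially"
      using uniform_limitD[OF g, of 1] by simp
    moreover have "eventually (\<lambda>n. B ^ q n > (M + 1) / \<rho>) sequentially"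
      using filterlim_compose[OF B_top filterlim_subseq[OF q]] by (simp add: filterlim_at_top_dense)
    ultimately have "eventually (\<lambda>n. False) sequentially"
    proof eventually_elim
      case (elim n)
      have "norm ((E ^^ q n) x) \<le> M + 1" if "norm (z - x) = \<rho>" for x
      proof -
        have x: "x \<in> cball z \<rho>" using that by (simp add: dist_norm)
        then have "norm ((E ^^ q n) x - g x) < 1" using elim by (auto simp: dist_norm)
        then show ?thesis using M[OF x] norm_triangle_sub[of "(E ^^ q n) x" "g x"] by linarith
      qed
      then have "norm ((deriv ^^ 1) (E ^^ q n) z) \<le> fact 1 * (M + 1) / \<rho> ^ 1"
        by (intro Cauchy_inequality holomorphic_E_iter continuous_on_E_iter \<rho>)
      then show False using norm_deriv_E_iter_ge[OF z, of "q n"] elim by simp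
    qed
    then show False by simp
  next
    assume inf: "\<forall>M. eventually (\<lambda>n. \<forall>x\<in>cball z \<rho>. norm ((E ^^ q n) x) \<ge> M) sequentially"
    \<comment> \<open>The 12 is the constant of \<open>Bloch_general\<close>; radius 7 exceeds
      \<open>pi\<close>, so the covered disc meets a line at an odd multiple of
      \<open>pi\<close>.\<close>
    have "eventually (\<lambda>n. B ^ n > 12 * 7 / \<rho>) sequentially"
      using B_top by (simp add: filterlim_at_top_dense)
    then obtain n where n: "B ^ n > 12 * 7 / \<rho>" by (auto simp: eventually_sequentially)
    have "12 * 7 / \<rho> \<le> norm (deriv (E ^^ n) z)" using n norm_deriv_E_iter_ge[OF z, of n] by linarith
    then have r7: "7 \<le> \<rho> * norm (deriv (E ^^ n) z) / 12" using \<rho> by (simp add: field_simps)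
    obtain b where b: "ball b 7 \<subseteq> (E ^^ n) ` ball z \<rho>"
      by (rule Bloch_general[OF holomorphic_E_iter[of n "ball z \<rho>"] _ _ r7]) (use \<rho> in auto)
    \<comment> \<open>\<open>y\<close> is the midpoint of the period interval containing
      \<open>Im b\<close>, hence within \<open>pi\<close> of it.\<close>
    define k where "k = \<lfloor>Im b / (2 * pi)\<rfloor>"
    define y where "y = (2 * real_of_int k + 1) * pi"
    have "real_of_int k \<le> Im b / (2 * pi)" "Im b / (2 * pi) < real_of_int k + 1"
      unfolding k_def by linarith+
    then have "real_of_int k * (2 * pi) \<le> Im b" "Im b < (real_of_int k + 1) * (2 * pi)"
      by (simp_all add: field_simps)
    then have "\<bar>y - Im b\<bar> \<le> pi" unfolding y_def by (simp add: algebra_simps abs_le_iff)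
    then have "\<bar>y - Im b\<bar> < 7" using pi_less_4 by linarith
    then have "Complex (Re b) y \<in> ball b 7"
      by (simp add: dist_norm cmod_def abs_minus_commute)
    then obtain w where w: "w \<in> ball z \<rho>" "(E ^^ n) w = Complex (Re b) y" using b by (metis imageE subsetD)
    have "cos y = - 1"
    proof -
      have "y = pi + 2 * pi * real_of_int k" by (simp add: y_def algebra_simps)
      then show ?thesis by (simp add: cos_add)
    qed
    then have "Re (E ((E ^^ n) w)) = - exp (Re b - B)" unfolding w E_eq_exp by (simp add: Re_exp)
    then have "Re ((E ^^ Suc n) w) < 0" by simp
    then have neg: "Re ((E ^^ Suc n) w) < B" using B_gt_1 by linarith
    have "eventually (\<lambda>n. \<forall>x\<in>cball z \<rho>. norm ((E ^^ q n) x) \<ge> 1) sequentially" using inf by blast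
    then obtain N where N: "\<And>m. m \<ge> N \<Longrightarrow> \<forall>x\<in>cball z \<rho>. norm ((E ^^ q m) x) \<ge> 1"
      by (auto simp: eventually_sequentially)
    define m where "m = max N (Suc (Suc n))"
    have "Suc n < q m" using seq_suble[OF q, of m] by (simp add: m_def)
    then have "norm ((E ^^ q m) w) < 1" by (rule norm_E_iter_less_1[OF neg])
    moreover have "norm ((E ^^ q m) w) \<ge> 1" using N[of m] w by (auto simp: m_def)
    ultimately show False by simp
  qed
qed

lemma julia_set_eq: "julia_set E = X"
  using X_imp_not_normal not_X_imp_normal by (auto simp: julia_set_def fatou_set_def)

section \<open>Inverse branches and the order on a hair\<close>

text \<open>The inverse branch of \<open>E\<close> with values in the strip of half-height
  \<open>pi\<close> about height \<open>2 * pi * k\<close>.\<close>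

definition L :: "int \<Rightarrow> complex \<Rightarrow> complex" where
  "L k w = Ln w + of_real B + \<i> * of_real (2 * pi * of_int k)"

lemma Re_L: "w \<noteq> 0 \<Longrightarrow> Re (L k w) = ln (norm w) + B"
  by (simp add: L_def)

lemma Im_L: "Im (L k w) = Im (Ln w) + 2 * pi * of_int k"
  by (simp add: L_def)

lemma Im_L_near: "0 < Re w \<Longrightarrow> \<bar>Im (L k w) - 2 * pi * of_int k\<bar> < pi / 2"
  using Re_Ln_pos_lt_imp[of w] by (simp add: Im_L)

lemma E_L: "w \<noteq> 0 \<Longrightarrow> E (L k w) = w"
proof -
  assume "w \<noteq> 0"
  have "exp (\<i> * of_real (2 * pi * of_int k)) = 1"
    using exp_eq_1 by (auto simp: mult_ac)
  then show ?thesis using \<open>w \<noteq> 0\<close> by (simp add: E_eq_exp L_def exp_add exp_diff)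
qed

lemma L_E:
  assumes "- pi < Im z - 2 * pi * of_int k" "Im z - 2 * pi * of_int k \<le> pi"
  shows "L k (E z) = z"
proof -
  define u where "u = z - of_real B - \<i> * of_real (2 * pi * of_int k)"
  have "exp (\<i> * of_real (2 * pi * of_int k)) = 1"
    using exp_eq_1 by (auto simp: mult_ac)
  then have "E z = exp u" by (simp add: E_eq_exp u_def exp_diff)
  moreover have "Ln (exp u) = u" using assms by (intro Ln_exp) (auto simp: u_def)
  ultimately show ?thesis by (simp add: L_def u_def)
qed

text \<open>The derivative of \<open>L k\<close> is \<open>1 / z\<close>, bounded by
  \<open>1 / r\<close> on a convex half-plane. The case \<open>r = B\<close> contracts uniformly on
  \<open>X\<close>; large \<open>r\<close> gives the gain in the covering argument.\<close>

lemma L_lipschitz: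
  assumes "0 < r" "r \<le> Re z" "r \<le> Re w"
  shows "dist (L k z) (L k w) \<le> (1 / r) * dist z w"
  unfolding dist_norm
proof (rule field_differentiable_bound[where S = "{z. r \<le> Re z}" and f' = "\<lambda>z. 1 / z"])
  show "convex {z. r \<le> Re z}" by (rule convex_halfspace_Re_ge)
  fix x assume "x \<in> {z. r \<le> Re z}"
  then have x: "r \<le> Re x" by simp
  then have "x \<notin> \<real>\<^sub>\<le>\<^sub>0" using assms by (auto simp: complex_nonpos_Reals_iff)
  then show "(L k has_field_derivative 1 / x) (at x within {z. r \<le> Re z})"
    unfolding L_def[abs_def] by (auto intro!: derivative_eq_intros simp: field_simps)
  have "r \<le> norm x" using x complex_Re_le_cmod[of x] by linarith
  then show "norm (1 / x) \<le> 1 / r" using assms by (simp add: norm_divide frac_le)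
qed (use assms in auto)

lemma continuous_on_L: "continuous_on {z. 0 < Re z} (L k)"
  unfolding L_def[abs_def]
  by (intro continuous_intros) (auto simp: complex_nonpos_Reals_iff)

lemma Re_L_ge:
  assumes "B \<le> Re w" shows "B \<le> Re (L k w)"
proof -
  have "1 \<le> norm w" "w \<noteq> 0" using assms B_gt_1 complex_Re_le_cmod[of w] by auto
  then show ?thesis by (simp add: Re_L)
qed

lemma L_in_X:
  assumes "w \<in> X" shows "L k w \<in> X"
proof -
  have "B \<le> Re w" using X_Re_ge0[OF assms] .
  moreover then have "w \<noteq> 0" using B_gt_1 by auto
  ultimately show ?thesis using X_iff_E[of "L k w"] assms by (simp add: E_L Re_L_ge)
qed

section \<open>Itineraries and expansion along a hair\<close>

abbreviation itin :: "complex \<Rightarrow> nat \<Rightarrow> int" where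
  "itin \<equiv> itinerary E"

lemma itin_eqI:
  assumes "- pi \<le> Im ((E ^^ j) z) - 2 * pi * of_int k" "Im ((E ^^ j) z) - 2 * pi * of_int k < pi"
  shows "itin z j = k"
  unfolding itinerary_def by (rule floor_unique) (use assms in \<open>auto simp: field_simps\<close>)

lemma itin_bounds:
  "- pi \<le> Im ((E ^^ j) z) - 2 * pi * of_int (itin z j)" "Im ((E ^^ j) z) - 2 * pi * of_int (itin z j) < pi"
proof -
  define t where "t = (Im ((E ^^ j) z) + pi) / (2 * pi)"
  have "of_int \<lfloor>t\<rfloor> * (2 * pi) \<le> t * (2 * pi)" "t * (2 * pi) < (of_int \<lfloor>t\<rfloor> + 1) * (2 * pi)"
    by (intro mult_right_mono mult_strict_right_mono; simp)+
  moreover have "t * (2 * pi) = Im ((E ^^ j) z) + pi" by (simp add: t_def)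
  ultimately have "of_int \<lfloor>t\<rfloor> * (2 * pi) \<le> Im ((E ^^ j) z) + pi" "Im ((E ^^ j) z) + pi < (of_int \<lfloor>t\<rfloor> + 1) * (2 * pi)"
    by simp_all
  moreover have "itin z j = \<lfloor>t\<rfloor>" by (simp add: itinerary_def t_def)
  ultimately show "- pi \<le> Im ((E ^^ j) z) - 2 * pi * of_int (itin z j)" "Im ((E ^^ j) z) - 2 * pi * of_int (itin z j) < pi"
    by (simp_all add: algebra_simps)
qed

lemma itin_iter: "itin ((E ^^ n) z) j = itin z (n + j)"
  by (simp add: itinerary_def add.commute[of n] funpow_add)

text \<open>Itinerary strips contain their lower edge, whereas those of \<open>Ln\<close> contain
  the upper one. The mismatch is harmless: on the edge \<open>E\<close> is negative, which is
  impossible on \<open>X\<close>.\<close>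

lemma X_eq_L:
  assumes "z \<in> X" shows "z = L (itin z 0) (E z)"
proof (rule sym, rule L_E)
  have b: "- pi \<le> Im z - 2 * pi * of_int (itin z 0)" "Im z - 2 * pi * of_int (itin z 0) < pi"
    using itin_bounds[where z = z and j = 0] by auto
  show "Im z - 2 * pi * of_int (itin z 0) \<le> pi" using b by linarith
  have "Im z - 2 * pi * of_int (itin z 0) \<noteq> - pi"
  proof
    assume "Im z - 2 * pi * of_int (itin z 0) = - pi"
    then have "Im z = - pi + 2 * pi * of_int (itin z 0)" by simp
    then have "cos (Im z) = -1" by (simp add: cos_add)
    then have "Re (E z) = - exp (Re z - B)" by (simp add: E_eq_exp Re_exp)
    then have "Re (E z) < 0" by simp
    moreover have "B \<le> Re (E z)" using X_Re_ge0[OF X_E[OF assms]] .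
    ultimately show False using B_gt_1 by linarith
  qed
  then show "- pi < Im z - 2 * pi * of_int (itin z 0)" using b by linarith
qed

text \<open>The image lies in the right half-plane, where arguments are below \<open>pi / 2\<close>;
  this halves the strip given by the itinerary.\<close>

lemma X_Im_near:
  assumes "z \<in> X" shows "\<bar>Im z - 2 * pi * of_int (itin z 0)\<bar> < pi / 2"
proof -
  have "0 < Re (E z)" using X_Re_ge0[OF X_E[OF assms]] B_gt_1 by linarith
  from Im_L_near[OF this, of "itin z 0"] show ?thesis using X_eq_L[OF assms] by simp
qed

lemma Im_diff_less_pi:
  assumes "z \<in> X" "w \<in> X" "itin z n = itin w n"
  shows "\<bar>Im ((E ^^ n) z) - Im ((E ^^ n) w)\<bar> < pi"
proof -
  define c where "c = 2 * pi * of_int (itin w n)"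
  have "\<bar>Im ((E ^^ n) z) - c\<bar> < pi / 2" "\<bar>Im ((E ^^ n) w) - c\<bar> < pi / 2"
    using X_Im_near[OF X_iter[OF assms(1), of n]] X_Im_near[OF X_iter[OF assms(2), of n]] assms(3)
    by (auto simp: itin_iter c_def)
  then show ?thesis by linarith
qed

lemma E_expanding:
  assumes "z \<in> X" "w \<in> X" "itin z 0 = itin w 0"
  shows "B * dist z w \<le> dist (E z) (E w)"
proof -
  have "dist z w = dist (L (itin z 0) (E z)) (L (itin z 0) (E w))"
    using X_eq_L[OF assms(1)] X_eq_L[OF assms(2)] assms(3) by metis
  also have "\<dots> \<le> (1 / B) * dist (E z) (E w)"
    using X_Re_ge0[OF X_E[OF assms(1)]] X_Re_ge0[OF X_E[OF assms(2)]] B_gt_1 by (intro L_lipschitz) auto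
  finally show ?thesis using B_gt_1 by (simp add: field_simps)
qed

lemma E_iter_expanding:
  assumes "z \<in> X" "w \<in> X" "itin z = itin w"
  shows "B ^ n * dist z w \<le> dist ((E ^^ n) z) ((E ^^ n) w)"
proof (induction n)
  case (Suc n)
  have "B ^ Suc n * dist z w = B * (B ^ n * dist z w)" by simp
  also have "\<dots> \<le> B * dist ((E ^^ n) z) ((E ^^ n) w)"
    using Suc B_gt_1 by (intro mult_left_mono) auto
  also have "\<dots> \<le> dist (E ((E ^^ n) z)) (E ((E ^^ n) w))"
    using assms by (intro E_expanding X_iter) (auto simp: itin_iter)
  finally show ?case by simp
qed simp

lemma bounded_dist_imp_eq:
  assumes "z \<in> X" "w \<in> X" "itin z = itin w" "\<And>n. dist ((E ^^ n) z) ((E ^^ n) w) \<le> K"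
  shows "z = w"
proof (rule ccontr)
  assume "z \<noteq> w"
  then have d: "0 < dist z w" by simp
  have "eventually (\<lambda>n. B ^ n > K / dist z w) sequentially"
    using B_power_at_top by (simp add: filterlim_at_top_dense)
  then obtain n where "B ^ n > K / dist z w" by (auto simp: eventually_sequentially)
  then have "B ^ n * dist z w > K" using d by (simp add: field_simps)
  then show False using assms(4)[of n] E_iter_expanding[OF assms(1-3), of n] by linarith
qed

text \<open>
  A gap of 2 between the real parts multiplies the modulus by at least 7, and the imaginary parts of
  the images are too close to account for this, so the gap persists.
\<close>

lemma dominance:
  assumes "z \<in> X" "w \<in> X" "itin z 1 = itin w 1" "Re w + 2 < Re z"
  shows "Re (E w) + 2 < Re (E z)"
proof (rule ccontr)
  assume neg: "\<not> Re (E w) + 2 < Re (E z)"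
  have pos: "B \<le> Re (E z)" "B \<le> Re (E w)"
    using X_Re_ge0[OF X_E[OF assms(1)]] X_Re_ge0[OF X_E[OF assms(2)]] .
  have im: "\<bar>Im (E z) - Im (E w)\<bar> < pi" using Im_diff_less_pi[OF assms(1,2), of 1] assms(3) by simp
  have w1: "1 < norm (E w)" using pos B_gt_1 complex_Re_le_cmod[of "E w"] by linarith
  \<comment> \<open>\<open>v\<close> borrows the imaginary part of \<open>E w\<close>. As
    \<open>0 < Re (E z) \<le> Re (E w) + 2\<close>, its modulus is at most that of
    \<open>E w + 2\<close>.\<close>
  define v where "v = Complex (Re (E z)) (Im (E w))"
  have "norm (E z) \<le> norm v + norm (E z - v)" by (metis norm_triangle_sub)
  moreover have "norm (E z - v) = \<bar>Im (E z) - Im (E w)\<bar>" by (simp add: cmod_def v_def)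
  moreover have "norm v \<le> norm (E w + 2)"
    unfolding cmod_def v_def using pos neg B_gt_1 by (auto intro!: real_sqrt_le_mono power_mono)
  moreover have "norm (E w + 2) \<le> norm (E w) + 2" by (metis norm_numeral norm_triangle_ineq)
  ultimately have "norm (E z) < norm (E w) + 2 + pi" using im by linarith
  moreover have "pi < 4" by (rule pi_less_4)
  ultimately have 1: "norm (E z) < 7 * norm (E w)" using w1 by linarith
  have "norm (E z) = exp (Re z - Re w) * norm (E w)" by (simp add: norm_E flip: exp_add)
  moreover have "7 \<le> exp (Re z - Re w)"
  proof -
    have "8/3 \<le> exp (1::real)" using e_approx_32 unfolding abs_le_iff by simp
    then have "(8/3)\<^sup>2 \<le> (exp (1::real))\<^sup>2" by (intro power_mono) auto
    also have "(exp 1)\<^sup>2 = exp (2::real)" using exp_double[of "1::real"] by simp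
    also have "\<dots> \<le> exp (Re z - Re w)" using assms by simp
    finally show ?thesis by (simp add: power2_eq_square)
  qed
  ultimately have "7 * norm (E w) \<le> norm (E z)" by (simp add: mult_right_mono)
  then show False using 1 by simp
qed

text \<open>One time \<open>n\<close> suffices, since by \<open>dominance\<close> a gap above 2
  persists at all later times.\<close>

definition below :: "complex \<Rightarrow> complex \<Rightarrow> bool" where
  "below w z \<longleftrightarrow> (\<exists>n. Re ((E ^^ n) w) + 2 < Re ((E ^^ n) z))"

lemma dominance_iter:
  assumes "z \<in> X" "w \<in> X" "itin z = itin w" "Re ((E ^^ n) w) + 2 < Re ((E ^^ n) z)" "n \<le> m"
  shows "Re ((E ^^ m) w) + 2 < Re ((E ^^ m) z)"
  using assms(5)
proof (induction m rule: dec_induct)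
  case (step m)
  have "Re (E ((E ^^ m) w)) + 2 < Re (E ((E ^^ m) z))"
    by (rule dominance) (use assms step in \<open>auto simp: X_iter itin_iter\<close>)
  then show ?case by simp
qed (rule assms)

lemma below_asym:
  assumes "z \<in> X" "w \<in> X" "itin z = itin w" "below w z" shows "\<not> below z w"
proof
  assume "below z w"
  then obtain m where m: "Re ((E ^^ m) z) + 2 < Re ((E ^^ m) w)" by (auto simp: below_def)
  obtain n where n: "Re ((E ^^ n) w) + 2 < Re ((E ^^ n) z)" using assms by (auto simp: below_def)
  have "Re ((E ^^ max m n) w) + 2 < Re ((E ^^ max m n) z)"
    by (rule dominance_iter[OF assms(1-3) n]) simp
  moreover have "Re ((E ^^ max m n) z) + 2 < Re ((E ^^ max m n) w)"
    by (rule dominance_iter[OF assms(2,1) assms(3)[symmetric] m]) simp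
  ultimately show False by simp
qed

text \<open>Distances grow like \<open>B^n\<close> while imaginary parts stay within
  \<open>pi\<close>, so the real parts must carry the growth.\<close>

lemma Re_diff_at_top:
  assumes "z \<in> X" "w \<in> X" "itin z = itin w" "z \<noteq> w"
  shows "eventually (\<lambda>n. K < \<bar>Re ((E ^^ n) z) - Re ((E ^^ n) w)\<bar>) sequentially"
proof -
  have d: "0 < dist z w" using assms by simp
  have "eventually (\<lambda>n. B ^ n > (K + pi) / dist z w) sequentially"
    using B_power_at_top by (simp add: filterlim_at_top_dense)
  then show ?thesis
  proof eventually_elim
    case (elim n)
    then have "K + pi < B ^ n * dist z w" using d by (simp add: field_simps)
    also have "\<dots> \<le> norm ((E ^^ n) z - (E ^^ n) w)" using E_iter_expanding[OF assms(1-3)] by (simp add: dist_norm)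
    also have "\<dots> \<le> \<bar>Re ((E ^^ n) z) - Re ((E ^^ n) w)\<bar> + \<bar>Im ((E ^^ n) z) - Im ((E ^^ n) w)\<bar>"
      using cmod_le[of "(E ^^ n) z - (E ^^ n) w"] by simp
    finally show ?case using Im_diff_less_pi[OF assms(1,2), of n] assms(3) by simp
  qed
qed

lemma below_linear:
  assumes "z \<in> X" "w \<in> X" "itin z = itin w" "z \<noteq> w"
  shows "below z w \<or> below w z"
proof -
  obtain n where "2 < \<bar>Re ((E ^^ n) z) - Re ((E ^^ n) w)\<bar>"
    using Re_diff_at_top[OF assms, of 2] by (auto simp: eventually_sequentially)
  then have "Re ((E ^^ n) w) + 2 < Re ((E ^^ n) z) \<or> Re ((E ^^ n) z) + 2 < Re ((E ^^ n) w)" by linarith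
  then show ?thesis by (auto simp: below_def)
qed

lemma below_Re_diff_at_top:
  assumes "z \<in> X" "w \<in> X" "itin z = itin w" "below w z"
  shows "eventually (\<lambda>n. Re ((E ^^ n) w) + K < Re ((E ^^ n) z)) sequentially"
proof -
  obtain m where m: "Re ((E ^^ m) w) + 2 < Re ((E ^^ m) z)" using assms by (auto simp: below_def)
  then have "z \<noteq> w" by auto
  from Re_diff_at_top[OF assms(1-3) this, of K] eventually_ge_at_top[of m]
  show ?thesis
  proof eventually_elim
    case (elim n)
    then show ?case using dominance_iter[OF assms(1-3) m, of n] by linarith
  qed
qed

end

section \<open>Parametrisation of a hair from its minimal point\<close>

text \<open>The new modulus lies between half of \<open>norm w * exp t\<close> and that value, so
  its logarithm is off by at most 1. Both arguments lie within \<open>pi / 2\<close> of 0, so the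
  imaginary error is below 4.\<close>

lemma Ln_add_norm_bound:
  assumes "0 < Re w" "0 \<le> t"
  shows "norm (Ln (w + of_real (norm w * (exp t - 1))) - Ln w - of_real t) \<le> 5"
proof -
  define r where "r = norm w"
  define v where "v = w + of_real (r * (exp t - 1))"
  have r: "0 < r" "w \<noteq> 0" using assms by (auto simp: r_def)
  have et: "1 \<le> exp t" using assms by simp
  have nn: "0 \<le> r * (exp t - 1)" using r et by simp
  have Rev: "Re v = Re w + r * (exp t - 1)" "Im v = Im w" by (simp_all add: v_def)
  then have "0 < Re v" using nn assms by linarith
  then have v: "v \<noteq> 0" by auto
  have "norm v \<le> r + norm (of_real (r * (exp t - 1)) :: complex)"
    unfolding v_def r_def by (rule norm_triangle_ineq)
  then have up: "norm v \<le> r * exp t" using nn by (simp only: norm_of_real) (simp add: algebra_simps)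
  \<comment> \<open>For \<open>exp t \<ge> 2\<close> the real part alone suffices; otherwise
    \<open>norm v \<ge> norm w\<close> does.\<close>
  have low: "r * exp t \<le> 2 * norm v"
  proof (cases "2 \<le> exp t")
    case True
    have "r * exp t \<le> 2 * (r * (exp t - 1))" using True r by (simp add: algebra_simps)
    also have "\<dots> \<le> 2 * norm v" using Rev assms complex_Re_le_cmod[of v] by linarith
    finally show ?thesis .
  next
    case False
    have "norm w \<le> norm v"
      unfolding cmod_def Rev using assms nn by (intro real_sqrt_le_mono add_right_mono power_mono) auto
    moreover have "r * exp t \<le> r * 2" using False r by (intro mult_left_mono) auto
    ultimately show ?thesis by (simp add: r_def)
  qed
  have lnr: "ln (r * exp t) = ln r + t" using r by (simp add: ln_mult)
  have "ln (norm v) \<le> ln (r * exp t)" using up v r by (subst ln_le_cancel_iff) auto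
  moreover have "ln (r * exp t) \<le> ln (2 * norm v)" using low v r by (subst ln_le_cancel_iff) auto
  moreover have "ln (2 * norm v) = ln 2 + ln (norm v)" using v by (simp add: ln_mult)
  moreover have "ln 2 \<le> (1 :: real)" using ln_2_less_1 by simp
  moreover have "Re (Ln v - Ln w - of_real t) = ln (norm v) - ln r - t" using v r by (simp add: r_def)
  ultimately have re: "\<bar>Re (Ln v - Ln w - of_real t)\<bar> \<le> 1" using lnr by linarith
  have "\<bar>Im (Ln v - Ln w - of_real t)\<bar> < pi"
    using Re_Ln_pos_lt_imp[OF assms(1)] Re_Ln_pos_lt_imp[OF \<open>0 < Re v\<close>] by (simp; linarith)
  then have "norm (Ln v - Ln w - of_real t) \<le> 5"
    using re cmod_le[of "Ln v - Ln w - of_real t"] pi_less_4 by linarith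
  then show ?thesis by (simp add: v_def r_def)
qed

context exp_family
begin

text \<open>
  The recursion for \<open>tau\<close> says that adding \<open>tau z (Suc n) t\<close> to the modulus of \<open>E^(n+1) z\<close> multiplies it
  by \<open>exp (tau z n t)\<close>, so one step of pulling back moves the approximation by a bounded amount only.
\<close>

primrec tau :: "complex \<Rightarrow> nat \<Rightarrow> real \<Rightarrow> real" where
  "tau z 0 t = t"
| "tau z (Suc n) t = norm ((E ^^ Suc n) z) * (exp (tau z n t) - 1)"

text \<open>The shifted orbit point at time \<open>m + n\<close> is pulled back \<open>n\<close>
  times along the itinerary of \<open>z\<close>. The limit in \<open>n\<close> will be the
  \<open>m\<close>-th image of the curve point with parameter \<open>t\<close>.\<close>

primrec curve_approx :: "complex \<Rightarrow> nat \<Rightarrow> nat \<Rightarrow> real \<Rightarrow> complex" where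
  "curve_approx z 0 m t = (E ^^ m) z + of_real (tau z m t)"
| "curve_approx z (Suc n) m t = L (itin z m) (curve_approx z n (Suc m) t)"

definition hair_curve :: "complex \<Rightarrow> nat \<Rightarrow> real \<Rightarrow> complex" where
  "hair_curve z m t = lim (\<lambda>n. curve_approx z n m t)"

lemma tau_nonneg: "0 \<le> t \<Longrightarrow> 0 \<le> tau z n t"
  by (induction n) auto

lemma tau_0 [simp]: "tau z n 0 = 0"
  by (induction n) auto

lemma continuous_on_tau: "continuous_on S (tau z n)"
  by (induction n) (auto intro!: continuous_intros)

text \<open>Each step applies \<open>exp\<close>, which expands distances on the nonnegative axis,
  and multiplies by a modulus of at least \<open>B\<close>. This separates the parameters of the
  curve.\<close>

lemma tau_expanding:
  assumes "z \<in> X" "0 \<le> t" "t \<le> u"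
  shows "B ^ n * (u - t) \<le> tau z n u - tau z n t"
proof (induction n)
  case (Suc n)
  define a b where "a = tau z n t" and "b = tau z n u"
  have "0 \<le> B ^ n * (u - t)" using B_gt_1 assms by simp
  then have ab: "a \<le> b" "0 \<le> a" using Suc tau_nonneg[OF assms(2)] by (auto simp: a_def b_def)
  have "b - a \<le> exp a * (b - a)" using ab mult_right_mono[of 1 "exp a" "b - a"] by simp
  also have "\<dots> \<le> exp a * (exp (b - a) - 1)"
    by (rule mult_left_mono) (use exp_ge_add_one_self[of "b - a"] in linarith, simp)
  also have "\<dots> = exp b - exp a" by (simp add: exp_diff field_simps)
  finally have e: "b - a \<le> exp b - exp a" .
  have Bn: "B \<le> norm ((E ^^ Suc n) z)"
    using X_Re_ge[OF assms(1), of "Suc n"] complex_Re_le_cmod[of "(E ^^ Suc n) z"] by linarith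
  have "B ^ Suc n * (u - t) = B * (B ^ n * (u - t))" by simp
  also have "\<dots> \<le> B * (b - a)" using Suc B_gt_1 by (auto simp: a_def b_def)
  also have "\<dots> \<le> norm ((E ^^ Suc n) z) * (exp b - exp a)"
    using Bn e ab B_gt_1 by (intro mult_mono) auto
  also have "\<dots> = tau z (Suc n) u - tau z (Suc n) t" by (simp add: a_def b_def algebra_simps)
  finally show ?case .
qed simp

lemma Re_curve_approx:
  assumes "z \<in> X" "0 \<le> t" shows "B \<le> Re (curve_approx z n m t)"
proof (induction n arbitrary: m)
  case 0
  then show ?case using X_Re_ge[OF assms(1), of m] tau_nonneg[OF assms(2), of z m] by simp
qed (simp add: Re_L_ge)

lemma continuous_on_curve_approx:
  assumes "z \<in> X" shows "continuous_on {0..} (curve_approx z n m)"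
proof (induction n arbitrary: m)
  case 0
  show ?case by (auto intro!: continuous_intros continuous_on_tau)
next
  case (Suc n)
  have "continuous_on {0..} (\<lambda>t. L (itin z m) (curve_approx z n (Suc m) t))"
  proof (rule continuous_on_compose2[OF continuous_on_L Suc])
    show "curve_approx z n (Suc m) ` {0..} \<subseteq> {z. 0 < Re z}"
    proof (rule image_subsetI)
      fix t :: real assume "t \<in> {0..}"
      then show "curve_approx z n (Suc m) t \<in> {z. 0 < Re z}"
        using Re_curve_approx[OF assms, of t n "Suc m"] B_gt_1 by simp
    qed
  qed
  then show ?case by simp
qed

lemma curve_approx_0:
  assumes "z \<in> X" shows "curve_approx z n m 0 = (E ^^ m) z"
proof (induction n arbitrary: m)
  case (Suc n)
  then show ?case using X_eq_L[OF X_iter[OF assms, of m]] by (simp add: itin_iter)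
qed simp

text \<open>The case \<open>n = 0\<close> is \<open>Ln_add_norm_bound\<close>; every further
  pull-back contracts by \<open>1 / B\<close>.\<close>

lemma curve_approx_step:
  assumes "z \<in> X" "0 \<le> t"
  shows "norm (curve_approx z (Suc n) m t - curve_approx z n m t) \<le> 5 * (1 / B) ^ n"
proof (induction n arbitrary: m)
  case 0
  define w where "w = (E ^^ Suc m) z"
  have w: "0 < Re w" using X_Re_ge[OF assms(1), of "Suc m"] B_gt_1 unfolding w_def by linarith
  have "L (itin z m) w = (E ^^ m) z"
    using X_eq_L[OF X_iter[OF assms(1), of m]] by (simp add: w_def itin_iter)
  then have z: "(E ^^ m) z = Ln w + of_real B + \<i> * of_real (2 * pi * of_int (itin z m))"
    by (simp add: L_def)
  have "curve_approx z (Suc 0) m t - curve_approx z 0 m t =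
      Ln (w + of_real (norm w * (exp (tau z m t) - 1))) - Ln w - of_real (tau z m t)"
    unfolding curve_approx.simps tau.simps z w_def[symmetric] by (simp add: L_def)
  then show ?case using Ln_add_norm_bound[OF w tau_nonneg[OF assms(2), of z m]]
    by (simp only: power_0 mult_1_right)
next
  case (Suc n)
  have "norm (curve_approx z (Suc (Suc n)) m t - curve_approx z (Suc n) m t) =
     dist (L (itin z m) (curve_approx z (Suc n) (Suc m) t)) (L (itin z m) (curve_approx z n (Suc m) t))"
    by (simp add: dist_norm)
  also have "\<dots> \<le> (1 / B) * dist (curve_approx z (Suc n) (Suc m) t) (curve_approx z n (Suc m) t)"
    using B_gt_1 by (intro L_lipschitz Re_curve_approx[OF assms]) auto
  also have "\<dots> \<le> (1 / B) * (5 * (1 / B) ^ n)"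
    using B_gt_1 Suc[of "Suc m"] by (intro mult_left_mono) (auto simp: dist_norm)
  finally show ?case by simp
qed

lemma summable_curve_bound: "summable (\<lambda>n. 5 * (1 / B) ^ n)"
  using B_gt_1 by (intro summable_mult summable_geometric) auto

text \<open>The increments have a geometric majorant independent of \<open>t\<close>, so the
  Weierstrass test applies to the telescoping series.\<close>

lemma curve_approx_uniform_limit:
  assumes "z \<in> X"
  shows "uniform_limit {0..} (\<lambda>n. curve_approx z n m) (hair_curve z m) sequentially"
proof -
  define d where "d n t = curve_approx z (Suc n) m t - curve_approx z n m t" for n t
  define g where "g t = curve_approx z 0 m t + (\<Sum>n. d n t)" for t
  have "uniform_limit {0..} (\<lambda>n t. \<Sum>i<n. d i t) (\<lambda>t. \<Sum>i. d i t) sequentially"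
    by (rule Weierstrass_m_test[OF _ summable_curve_bound]) (use curve_approx_step[OF assms] in \<open>auto simp: d_def\<close>)
  then have "uniform_limit {0..} (\<lambda>n t. curve_approx z 0 m t + (\<Sum>i<n. d i t)) g sequentially"
    unfolding g_def by (intro uniform_limit_intros)
  moreover have "curve_approx z 0 m t + (\<Sum>i<n. d i t) = curve_approx z n m t" for n t
    unfolding d_def by (subst sum_lessThan_telescope) simp
  ultimately have lim: "uniform_limit {0..} (\<lambda>n. curve_approx z n m) g sequentially" by simp
  have "g t = hair_curve z m t" if "t \<in> {0..}" for t
    using tendsto_uniform_limitI[OF lim that] by (simp add: hair_curve_def limI)
  then show ?thesis using lim by (subst uniform_limit_cong'[where g = "\<lambda>n. curve_approx z n m" and i = g]) auto
qed

lemma curve_approx_tendsto: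
  assumes "z \<in> X" "0 \<le> t"
  shows "(\<lambda>n. curve_approx z n m t) \<longlonglongrightarrow> hair_curve z m t"
  using tendsto_uniform_limitI[OF curve_approx_uniform_limit[OF assms(1)]] assms(2) by simp

lemma continuous_on_hair_curve:
  assumes "z \<in> X" shows "continuous_on {0..} (hair_curve z m)"
  by (rule uniform_limit_theorem[OF _ curve_approx_uniform_limit[OF assms]])
     (auto intro!: always_eventually continuous_on_curve_approx assms)

lemma Re_hair_curve:
  assumes "z \<in> X" "0 \<le> t" shows "B \<le> Re (hair_curve z m t)"
  by (rule LIMSEQ_le_const[OF tendsto_Re[OF curve_approx_tendsto[OF assms]]])
     (use Re_curve_approx[OF assms] in auto)

lemma hair_curve_L:
  assumes "z \<in> X" "0 \<le> t"
  shows "hair_curve z m t = L (itin z m) (hair_curve z (Suc m) t)"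
proof (rule LIMSEQ_unique)
  show "(\<lambda>n. curve_approx z (Suc n) m t) \<longlonglongrightarrow> hair_curve z m t"
    by (rule LIMSEQ_Suc[OF curve_approx_tendsto[OF assms]])
  have "open {z. 0 < Re z}" by (rule open_halfspace_Re_gt)
  then have "isCont (L (itin z m)) (hair_curve z (Suc m) t)"
    using continuous_on_L[of "itin z m"] Re_hair_curve[OF assms, of "Suc m"] B_gt_1
    by (subst (asm) continuous_on_eq_continuous_at) auto
  then show "(\<lambda>n. curve_approx z (Suc n) m t) \<longlonglongrightarrow> L (itin z m) (hair_curve z (Suc m) t)"
    unfolding curve_approx.simps by (rule isCont_tendsto_compose[OF _ curve_approx_tendsto[OF assms]])
qed

lemma E_hair_curve:
  assumes "z \<in> X" "0 \<le> t" shows "E (hair_curve z m t) = hair_curve z (Suc m) t"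
proof -
  have "hair_curve z (Suc m) t \<noteq> 0" using Re_hair_curve[OF assms, of "Suc m"] B_gt_1 by auto
  then show ?thesis using hair_curve_L[OF assms, of m] by (simp add: E_L)
qed

lemma E_iter_hair_curve:
  assumes "z \<in> X" "0 \<le> t" shows "(E ^^ m) (hair_curve z 0 t) = hair_curve z m t"
  by (induction m) (simp_all add: E_hair_curve[OF assms])

lemma hair_curve_in_X:
  assumes "z \<in> X" "0 \<le> t" shows "hair_curve z 0 t \<in> X"
  by (simp add: X_def E_iter_hair_curve[OF assms] Re_hair_curve[OF assms])

lemma itin_hair_curve:
  assumes "z \<in> X" "0 \<le> t" shows "itin (hair_curve z 0 t) = itin z"
proof
  fix m
  have "0 < Re (hair_curve z (Suc m) t)" using Re_hair_curve[OF assms, of "Suc m"] B_gt_1 by linarith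
  from Im_L_near[OF this, of "itin z m"]
  have "\<bar>Im ((E ^^ m) (hair_curve z 0 t)) - 2 * pi * of_int (itin z m)\<bar> < pi / 2"
    by (simp only: E_iter_hair_curve[OF assms] flip: hair_curve_L[OF assms])
  then show "itin (hair_curve z 0 t) m = itin z m"
    using pi_gt_zero by (intro itin_eqI) linarith+
qed

lemma hair_curve_at_0:
  assumes "z \<in> X" shows "hair_curve z m 0 = (E ^^ m) z"
  using curve_approx_tendsto[OF assms, of 0 m] curve_approx_0[OF assms]
  by (simp add: LIMSEQ_const_iff)

text \<open>The error bound does not depend on \<open>m\<close> or \<open>t\<close>, so the growth
  of \<open>tau\<close> decides how curve points separate.\<close>

lemma hair_curve_near:
  assumes "z \<in> X" "0 \<le> t"
  shows "norm (hair_curve z m t - ((E ^^ m) z + of_real (tau z m t))) \<le> (\<Sum>n. 5 * (1 / B) ^ n)"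
proof -
  have "norm (curve_approx z n m t - curve_approx z 0 m t) \<le> (\<Sum>n. 5 * (1 / B) ^ n)" for n
  proof -
    have "curve_approx z n m t - curve_approx z 0 m t = (\<Sum>i<n. curve_approx z (Suc i) m t - curve_approx z i m t)"
      by (subst sum_lessThan_telescope) simp
    also have "norm \<dots> \<le> (\<Sum>i<n. 5 * (1 / B) ^ i)"
      by (rule sum_norm_le) (rule curve_approx_step[OF assms])
    also have "\<dots> \<le> (\<Sum>i. 5 * (1 / B) ^ i)"
      using B_gt_1 by (intro sum_le_suminf summable_curve_bound) auto
    finally show ?thesis .
  qed
  then have "norm (hair_curve z m t - curve_approx z 0 m t) \<le> (\<Sum>n. 5 * (1 / B) ^ n)"
    by (intro LIMSEQ_le_const2[OF tendsto_norm[OF tendsto_diff[OF curve_approx_tendsto[OF assms, of m] tendsto_const]]]) auto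
  then show ?thesis by simp
qed

text \<open>Injectivity follows since \<open>tau\<close> drives different parameters apart beyond
  the error \<open>K\<close>. If the curve missed a point \<open>w\<close> of the hair, the
  parameters below and above \<open>w\<close> would disconnect
  \<open>[0, \<infinity>)\<close>.\<close>

lemma minimal_imp_endpoint:
  assumes z: "z \<in> X" and min: "\<And>w. w \<in> X \<Longrightarrow> itin w = itin z \<Longrightarrow> \<not> below w z"
  shows "z \<in> endpoints E"
proof -
  define \<gamma> where "\<gamma> = hair_curve z 0"
  define K where "K = (\<Sum>n. 5 * (1 / B) ^ n)"
  have cont: "continuous_on {0..} \<gamma>" unfolding \<gamma>_def by (rule continuous_on_hair_curve[OF z])
  have inX: "\<gamma> t \<in> X" "itin (\<gamma> t) = itin z" if "0 \<le> t" for t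
    unfolding \<gamma>_def using hair_curve_in_X[OF z that] itin_hair_curve[OF z that] by auto
  have near: "norm ((E ^^ n) (\<gamma> t) - ((E ^^ n) z + of_real (tau z n t))) \<le> K" if "0 \<le> t" for n t
    using hair_curve_near[OF z that, of n] by (simp add: \<gamma>_def K_def E_iter_hair_curve[OF z that])
  have no_tie: "\<gamma> t \<noteq> \<gamma> u" if "0 \<le> t" "t < u" for t u
  proof
    assume eq: "\<gamma> t = \<gamma> u"
    have "eventually (\<lambda>n. B ^ n > 2 * K / (u - t)) sequentially"
      using B_power_at_top by (simp add: filterlim_at_top_dense)
    then obtain n where n: "B ^ n > 2 * K / (u - t)" by (auto simp: eventually_sequentially)
    then have "2 * K < B ^ n * (u - t)" using that by (simp add: field_simps)
    also have "\<dots> \<le> tau z n u - tau z n t" using that by (intro tau_expanding z) auto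
    also have "\<dots> \<le> norm (of_real (tau z n u - tau z n t) :: complex)" unfolding norm_of_real by simp
    also have "of_real (tau z n u - tau z n t) =
        ((E ^^ n) (\<gamma> t) - ((E ^^ n) z + of_real (tau z n t))) - ((E ^^ n) (\<gamma> u) - ((E ^^ n) z + of_real (tau z n u)))"
      using eq by simp
    also have "norm \<dots> \<le> K + K"
      using that by (intro order_trans[OF norm_triangle_ineq4] add_mono near) auto
    finally show False by simp
  qed
  then have inj: "inj_on \<gamma> {0..}" by (intro linorder_inj_onI) auto
  have Re_\<gamma>: "Re z + t - K \<le> Re (\<gamma> t)" if "0 \<le> t" for t
    using near[OF that, of 0] abs_Re_le_cmod[of "\<gamma> t - (z + of_real t)"] by (simp add: abs_le_iff)
  have lim: "filterlim (\<lambda>t. norm (\<gamma> t)) at_top at_top"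
  proof (rule filterlim_at_top_mono)
    show "filterlim (\<lambda>t. Re z + t - K) at_top at_top" by real_asymp
    show "eventually (\<lambda>t. Re z + t - K \<le> norm (\<gamma> t)) at_top"
      using eventually_ge_at_top[of 0]
    proof eventually_elim
      case (elim t)
      then show ?case using Re_\<gamma>[of t] complex_Re_le_cmod[of "\<gamma> t"] by linarith
    qed
  qed
  have "w \<in> \<gamma> ` {0..}" if w: "w \<in> X" "itin w = itin z" for w
  proof (rule ccontr)
    assume notin: "w \<notin> \<gamma> ` {0..}"
    have \<gamma>0: "\<gamma> 0 = z" unfolding \<gamma>_def using hair_curve_at_0[OF z, of 0] by simp
    define P where "P = {t \<in> {0..}. below (\<gamma> t) w}"
    define Q where "Q = {t \<in> {0..}. below w (\<gamma> t)}"
    \<comment> \<open>\<open>below\<close> is a union over \<open>n\<close> of strict inequalities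
      between continuous functions, so \<open>P\<close> and \<open>Q\<close> are relatively
      open.\<close>
    have cont_Re: "continuous_on {0..} (\<lambda>t. Re ((E ^^ n) (\<gamma> t)))" for n
      by (intro continuous_intros continuous_on_compose2[OF continuous_on_E_iter[of UNIV] cont]) auto
    have "openin (top_of_set {0..}) ({0..} \<inter> (\<lambda>t. Re ((E ^^ n) (\<gamma> t))) -` {..<Re ((E ^^ n) w) - 2})" for n
      by (rule continuous_openin_preimage_gen[OF cont_Re]) auto
    then have "openin (top_of_set {0..}) (\<Union>n. {0..} \<inter> (\<lambda>t. Re ((E ^^ n) (\<gamma> t))) -` {..<Re ((E ^^ n) w) - 2})"
      by blast
    also have "(\<Union>n. {0..} \<inter> (\<lambda>t. Re ((E ^^ n) (\<gamma> t))) -` {..<Re ((E ^^ n) w) - 2}) = P"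
      by (auto simp: P_def below_def less_diff_eq)
    finally have oP: "openin (top_of_set {0..}) P" .
    have "openin (top_of_set {0..}) ({0..} \<inter> (\<lambda>t. Re ((E ^^ n) (\<gamma> t))) -` {Re ((E ^^ n) w) + 2<..})" for n
      by (rule continuous_openin_preimage_gen[OF cont_Re]) auto
    then have "openin (top_of_set {0..}) (\<Union>n. {0..} \<inter> (\<lambda>t. Re ((E ^^ n) (\<gamma> t))) -` {Re ((E ^^ n) w) + 2<..})"
      by blast
    also have "(\<Union>n. {0..} \<inter> (\<lambda>t. Re ((E ^^ n) (\<gamma> t))) -` {Re ((E ^^ n) w) + 2<..}) = Q"
      by (auto simp: Q_def below_def)
    finally have oQ: "openin (top_of_set {0..}) Q" .
    have "{0..} \<subseteq> P \<union> Q"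
    proof
      fix t :: real assume t: "t \<in> {0..}"
      then have "\<gamma> t \<noteq> w" using notin by auto
      then show "t \<in> P \<union> Q"
        using below_linear[of "\<gamma> t" w] inX[of t] w t by (auto simp: P_def Q_def)
    qed
    moreover have "P \<inter> Q = {}"
      using below_asym[OF _ w(1)] inX w by (auto simp: P_def Q_def)
    moreover have "0 \<in> P"
    proof -
      have "z \<noteq> w" using notin \<gamma>0 by force
      then have "below z w" using below_linear[OF z w(1)] w min by auto
      then show ?thesis by (simp add: P_def \<gamma>0)
    qed
    moreover have "Q \<noteq> {}"
    proof -
      \<comment> \<open>By \<open>Re_\<gamma>\<close> this parameter gives real part at least
        \<open>Re w + 3\<close>.\<close>
      define t where "t = max 0 (Re w - Re z + K + 3)"
      have "Re w + 2 < Re (\<gamma> t)" using Re_\<gamma>[of t] by (simp add: t_def)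
      then have "below w (\<gamma> t)" unfolding below_def by (intro exI[of _ 0]) simp
      then have "t \<in> Q" by (simp add: Q_def t_def)
      then show ?thesis by blast
    qed
    moreover have "connected {0::real..}" by simp
    ultimately show False using oP oQ unfolding connected_openin by blast
  qed
  then have "\<gamma> ` {0..} = hair E (itin z)"
    using inX by (auto simp: hair_def julia_set_eq)
  moreover have "\<gamma> 0 = z" unfolding \<gamma>_def using hair_curve_at_0[OF z, of 0] by simp
  ultimately show ?thesis unfolding endpoints_def using cont inj lim by blast
qed

section \<open>Covering the points that are not minimal\<close>

text \<open>Imposing the bounds on the whole orbit makes \<open>T\<close> forward invariant, so
  coverings can be iterated. Up to the factor \<open>exp (B / 2)\<close>, the second bound is the
  square root of the modulus of the next point.\<close>

definition T :: "complex set" where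
  "T = {z \<in> X. \<forall>n. \<bar>Im ((E ^^ n) z)\<bar> \<le> Re ((E ^^ n) z) \<and> \<bar>Im ((E ^^ Suc n) z)\<bar> \<le> exp (Re ((E ^^ n) z) / 2)}"

lemma T_D:
  assumes "z \<in> T"
  shows "z \<in> X" "\<bar>Im z\<bar> \<le> Re z" "\<bar>Im (E z)\<bar> \<le> exp (Re z / 2)" "E z \<in> T"
proof -
  have *: "z \<in> X" "\<And>n. \<bar>Im ((E ^^ n) z)\<bar> \<le> Re ((E ^^ n) z)" "\<And>n. \<bar>Im ((E ^^ Suc n) z)\<bar> \<le> exp (Re ((E ^^ n) z) / 2)"
    using assms unfolding T_def by blast+
  show "z \<in> X" "\<bar>Im z\<bar> \<le> Re z" "\<bar>Im (E z)\<bar> \<le> exp (Re z / 2)"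
    using *(1) *(2)[of 0] *(3)[of 0] by auto
  have "\<bar>Im ((E ^^ n) (E z))\<bar> \<le> Re ((E ^^ n) (E z))" "\<bar>Im ((E ^^ Suc n) (E z))\<bar> \<le> exp (Re ((E ^^ n) (E z)) / 2)" for n
    using *(2)[of "Suc n"] *(3)[of "Suc n"] unfolding funpow_Suc_right comp_apply by blast+
  then show "E z \<in> T" using X_E[OF *(1)] by (simp add: T_def del: funpow.simps)
qed

lemma T_Re_ge:
  assumes "w \<in> T" "R \<le> norm w" shows "R / 2 \<le> Re w"
  using T_D(2)[OF assms(1)] cmod_le[of w] assms(2) by linarith

text \<open>The gap makes \<open>norm (E w)\<close> at most an eighth of \<open>norm (E z)\<close>,
  and the height of \<open>E z\<close> exceeds that of \<open>E w\<close> by less than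
  \<open>pi\<close>; hence it is small against the modulus.\<close>

lemma gap_imp_small_Im:
  assumes "z \<in> X" "w \<in> X" "itin z 1 = itin w 1" "Re w + 10 < Re z" "10 \<le> Re (E z)"
  shows "\<bar>Im (E z)\<bar> \<le> Re (E z)" "norm (E w) \<le> Re (E z) / 4"
proof -
  have "exp 1 \<ge> (2::real)" using exp_ge_add_one_self[of "1::real"] by simp
  then have "2 ^ 3 \<le> (exp (1::real)) ^ 3" by (intro power_mono) auto
  also have "(exp (1::real)) ^ 3 = exp 3" using exp_of_nat_mult[of 3 "1::real"] by simp
  also have "\<dots> \<le> exp (Re z - Re w)" using assms by simp
  finally have "8 * norm (E w) \<le> exp (Re z - Re w) * norm (E w)" by (intro mult_right_mono) auto
  also have "\<dots> = norm (E z)" by (simp add: norm_E flip: exp_add)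
  finally have 1: "8 * norm (E w) \<le> norm (E z)" .
  have 2: "\<bar>Im (E z) - Im (E w)\<bar> < pi" using Im_diff_less_pi[OF assms(1,2), of 1] assms(3) by simp
  have 3: "norm (E z) \<le> Re (E z) + \<bar>Im (E z)\<bar>" using cmod_le[of "E z"] assms(5) by simp
  show "\<bar>Im (E z)\<bar> \<le> Re (E z)"
    using 1 2 3 abs_Im_le_cmod[of "E w"] pi_less_4 assms(5) by linarith
  then show "norm (E w) \<le> Re (E z) / 4" using 1 3 by linarith
qed

lemma not_minimal_imp_eventually_T:
  assumes "z \<in> X" "w \<in> X" "itin z = itin w" "below w z"
  shows "\<exists>N. (E ^^ N) z \<in> T \<and> A \<le> Re ((E ^^ N) z)"
proof -
  define K where "K = max 10 A"
  obtain N where N: "\<And>n. n \<ge> N \<Longrightarrow> Re ((E ^^ n) w) + K < Re ((E ^^ n) z)"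
    using below_Re_diff_at_top[OF assms, of K] by (auto simp: eventually_sequentially)
  have w0: "0 < Re ((E ^^ n) w)" for n using X_Re_ge[OF assms(2), of n] B_gt_1 by linarith
  have big: "K < Re ((E ^^ n) z)" if "n \<ge> N" for n using N[OF that] w0[of n] by linarith
  have 1: "\<bar>Im ((E ^^ Suc n) z)\<bar> \<le> Re ((E ^^ Suc n) z)" "norm ((E ^^ Suc n) w) \<le> Re ((E ^^ Suc n) z) / 4" if "n \<ge> N" for n
  proof -
    have a: "10 \<le> Re (E ((E ^^ n) z))" using big[of "Suc n"] that by (simp add: K_def)
    have b: "Re ((E ^^ n) w) + 10 < Re ((E ^^ n) z)" using N[OF that] by (simp add: K_def)
    show "\<bar>Im ((E ^^ Suc n) z)\<bar> \<le> Re ((E ^^ Suc n) z)" "norm ((E ^^ Suc n) w) \<le> Re ((E ^^ Suc n) z) / 4"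
      using gap_imp_small_Im[OF X_iter[OF assms(1)] X_iter[OF assms(2)] _ b a] assms(3) by (simp_all add: itin_iter)
  qed
  have 2: "\<bar>Im ((E ^^ Suc (Suc n)) z)\<bar> \<le> exp (Re ((E ^^ Suc n) z) / 2)" if "n \<ge> N" for n
  proof -
    define x where "x = Re ((E ^^ Suc n) z)"
    \<comment> \<open>\<open>y\<close> is the square root of the target bound. It bounds the next
      point of the orbit of \<open>w\<close>, and \<open>y + 4 \<le> y * y\<close> absorbs the
      height difference \<open>pi\<close>.\<close>
    define y where "y = exp (x / 4)"
    have "10 \<le> x" using big[of "Suc n"] that by (simp add: x_def K_def)
    then have y: "7/2 \<le> y" using exp_ge_add_one_self[of "x / 4"] unfolding y_def by linarith
    have "\<bar>Im ((E ^^ Suc (Suc n)) z) - Im ((E ^^ Suc (Suc n)) w)\<bar> < pi"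
      using Im_diff_less_pi[OF assms(1,2), of "Suc (Suc n)"] assms(3) by simp
    moreover have "\<bar>Im ((E ^^ Suc (Suc n)) w)\<bar> \<le> norm ((E ^^ Suc (Suc n)) w)" by (rule abs_Im_le_cmod)
    moreover have "norm ((E ^^ Suc (Suc n)) w) \<le> y"
    proof -
      have "Re ((E ^^ Suc n) w) \<le> x / 4"
        using 1(2)[OF that] complex_Re_le_cmod[of "(E ^^ Suc n) w"] unfolding x_def by linarith
      then have "Re ((E ^^ Suc n) w) - B \<le> x / 4" using B_gt_1 by linarith
      then have "norm (E ((E ^^ Suc n) w)) \<le> y" unfolding norm_E y_def exp_le_cancel_iff .
      then show ?thesis by simp
    qed
    moreover have "y + 4 \<le> y * y"
    proof -
      have "7/2 * y \<le> y * y" using y by (intro mult_right_mono) auto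
      then show ?thesis using y by linarith
    qed
    moreover have "y * y = exp (x / 2)" by (simp add: y_def flip: exp_add)
    ultimately show ?thesis using pi_less_4 unfolding x_def by linarith
  qed
  \<comment> \<open>The bounds obtained from a gap at time \<open>N\<close> concern later points,
    hence the shift to \<open>Suc N\<close>.\<close>
  have "(E ^^ Suc N) z \<in> T"
    unfolding T_def
  proof (intro CollectI conjI allI X_iter assms(1))
    fix n
    have *: "(E ^^ n) ((E ^^ Suc N) z) = (E ^^ Suc (n + N)) z" "(E ^^ Suc n) ((E ^^ Suc N) z) = (E ^^ Suc (Suc (n + N))) z"
      by (simp_all add: funpow_add funpow_swap1)
    show "\<bar>Im ((E ^^ n) ((E ^^ Suc N) z))\<bar> \<le> Re ((E ^^ n) ((E ^^ Suc N) z))"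
      unfolding * by (rule 1) simp
    show "\<bar>Im ((E ^^ Suc n) ((E ^^ Suc N) z))\<bar> \<le> exp (Re ((E ^^ n) ((E ^^ Suc N) z)) / 2)"
      unfolding * by (rule 2) simp
  qed
  moreover have "A \<le> Re ((E ^^ Suc N) z)" using big[of "Suc N"] by (simp add: K_def)
  ultimately show ?thesis by blast
qed

section \<open>Gauge content of unit boxes\<close>

definition unit_box :: "real \<Rightarrow> real \<Rightarrow> complex set" where
  "unit_box a b = {z. a \<le> Re z \<and> Re z \<le> a + 1 \<and> b \<le> Im z \<and> Im z \<le> b + 1}"

text \<open>One branch serves the whole box: points lie within \<open>pi / 2\<close> of their strip
  centres and differ in height by at most 1, while distinct centres are at least
  \<open>2 * pi > pi + 1\<close> apart. The factor 3 bounds \<open>exp 1\<close>.\<close>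

lemma box_pullback:
  obtains k where "T \<inter> unit_box a b \<subseteq> L k ` {w \<in> T. exp (a - B) \<le> norm w \<and> norm w \<le> 3 * exp (a - B) \<and> \<bar>Im w\<bar> \<le> exp ((a + 1) / 2)}"
proof (cases "T \<inter> unit_box a b = {}")
  case False
  then obtain u where u: "u \<in> T" "u \<in> unit_box a b" by blast
  define k where "k = itin u 0"
  have "z \<in> L k ` {w \<in> T. exp (a - B) \<le> norm w \<and> norm w \<le> 3 * exp (a - B) \<and> \<bar>Im w\<bar> \<le> exp ((a + 1) / 2)}"
    if z: "z \<in> T" "z \<in> unit_box a b" for z
  proof
    have "itin z 0 = k"
    proof -
      have "\<bar>Im z - 2 * pi * of_int (itin z 0)\<bar> < pi / 2" "\<bar>Im u - 2 * pi * of_int k\<bar> < pi / 2"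
        using X_Im_near T_D(1) z u by (auto simp: k_def)
      moreover have "\<bar>Im z - Im u\<bar> \<le> 1" using z u by (auto simp: unit_box_def)
      ultimately have "\<bar>2 * pi * of_int (itin z 0) - 2 * pi * of_int k\<bar> < pi + 1" by linarith
      moreover have "2 * pi * of_int (itin z 0) - 2 * pi * of_int k = 2 * pi * of_int (itin z 0 - k)"
        by (simp add: algebra_simps)
      ultimately have "2 * pi * \<bar>of_int (itin z 0 - k)\<bar> < pi + 1" by (simp add: abs_mult)
      also have "\<dots> < 2 * pi * 1" using pi_gt3 by simp
      finally have "\<bar>real_of_int (itin z 0 - k)\<bar> < 1" by (subst (asm) mult_less_cancel_left_pos) auto
      then show ?thesis by linarith
    qed
    then show "z = L k (E z)" using X_eq_L[OF T_D(1)[OF z(1)]] by simp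
    have "exp (a - B) \<le> norm (E z)" using z by (simp add: norm_E unit_box_def)
    moreover have "norm (E z) \<le> 3 * exp (a - B)"
    proof -
      have "norm (E z) \<le> exp (1 + (a - B))" using z by (simp add: norm_E unit_box_def)
      also have "\<dots> = exp 1 * exp (a - B)" by (rule exp_add)
      also have "\<dots> \<le> 3 * exp (a - B)" using exp_le by (intro mult_right_mono) auto
      finally show ?thesis .
    qed
    moreover have "\<bar>Im (E z)\<bar> \<le> exp ((a + 1) / 2)"
    proof -
      have "exp (Re z / 2) \<le> exp ((a + 1) / 2)" using z by (simp add: unit_box_def)
      then show ?thesis using T_D(3)[OF z(1)] by linarith
    qed
    ultimately show "E z \<in> {w \<in> T. exp (a - B) \<le> norm w \<and> norm w \<le> 3 * exp (a - B) \<and> \<bar>Im w\<bar> \<le> exp ((a + 1) / 2)}"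
      using T_D(4)[OF z(1)] by simp
  qed
  then show ?thesis by (intro that[of k]) blast
qed (use that[of 0] in auto)

lemma L_lipschitz_T:
  assumes "0 < R" "S \<subseteq> {w \<in> T. R \<le> norm w}" "x \<in> S" "y \<in> S"
  shows "dist (L k x) (L k y) \<le> (2 / R) * dist x y"
proof -
  have "R / 2 \<le> Re x" "R / 2 \<le> Re y" using assms T_Re_ge[of x R] T_Re_ge[of y R] by blast+
  then show ?thesis using L_lipschitz[of "R / 2" x y k] assms by simp
qed

text \<open>The image strip is cut into at most \<open>4 * R / H\<close> pieces, each pulled back to
  diameter at most \<open>t = 6 * H / R\<close>. The product is 24, and \<open>t2\<close> supplies
  the logarithmic factor.\<close>

lemma content_box_base:
  assumes s: "0 \<le> s" and a: "0 < a" and H: "exp ((a + 1) / 2) \<le> exp (a - B)"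
    and t1: "6 * exp ((a + 1) / 2) / exp (a - B) < 1"
    and t2: "a / 4 \<le> ln (1 / (6 * exp ((a + 1) / 2) / exp (a - B)))"
  shows "gauge_content s 1 (T \<inter> unit_box a b) \<le> ennreal (24 * (a / 4) powr (-s))"
proof -
  define R where "R = exp (a - B)"
  define H where "H = exp ((a + 1) / 2)"
  define t where "t = 6 * H / R"
  have pos: "0 < R" "0 < H" "0 < t" by (auto simp: R_def H_def t_def)
  have HR: "H \<le> R" "t < 1" "a / 4 \<le> ln (1 / t)" using assms by (auto simp: R_def H_def t_def)
  obtain k where k: "T \<inter> unit_box a b \<subseteq> L k ` {w \<in> T. R \<le> norm w \<and> norm w \<le> 3 * R \<and> \<bar>Im w\<bar> \<le> H}"
    using box_pullback[of a b] unfolding R_def H_def by blast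
  \<comment> \<open>Each piece has width \<open>H\<close> and height \<open>2 * H\<close>, hence
    diameter at most \<open>3 * H\<close>.\<close>
  define V where "V i = {w \<in> T. R \<le> norm w \<and> \<bar>Im w\<bar> \<le> H \<and> real i * H \<le> Re w \<and> Re w \<le> real i * H + H}" for i :: nat
  define n where "n = nat \<lfloor>3 * R / H\<rfloor>"
  have V: "bounded (V i)" "diameter (V i) \<le> 3 * H" for i
  proof -
    have d: "norm (x - y) \<le> 3 * H" if "x \<in> V i" "y \<in> V i" for x y
      using that cmod_le[of "x - y"] by (auto simp: V_def)
    then show "bounded (V i)" unfolding bounded_two_points dist_norm by blast
    show "diameter (V i) \<le> 3 * H" by (rule diameter_le) (use d pos in auto)
  qed
  have "T \<inter> unit_box a b \<subseteq> (\<Union>i\<in>{..n}. L k ` V i)"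
  proof
    fix z assume "z \<in> T \<inter> unit_box a b"
    then obtain w where w: "z = L k w" "w \<in> T" "R \<le> norm w" "norm w \<le> 3 * R" "\<bar>Im w\<bar> \<le> H" using k by blast
    define i where "i = nat \<lfloor>Re w / H\<rfloor>"
    have "0 \<le> Re w" using T_Re_ge[OF w(2,3)] pos by linarith
    then have "0 \<le> Re w / H" using pos by simp
    then have i: "real i \<le> Re w / H" "Re w / H \<le> real i + 1" unfolding i_def by linarith+
    have "Re w / H \<le> 3 * R / H" using w complex_Re_le_cmod[of w] pos by (intro divide_right_mono) auto
    then have "i \<le> n" unfolding i_def n_def by (intro nat_mono floor_mono)
    moreover have "w \<in> V i" using w i pos by (auto simp: V_def field_simps)
    ultimately show "z \<in> (\<Union>i\<in>{..n}. L k ` V i)" using w by blast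
  qed
  then have "gauge_content s 1 (T \<inter> unit_box a b) \<le> gauge_content s 1 (\<Union>i\<in>{..n}. L k ` V i)"
    by (rule gauge_content_mono) simp
  also have "\<dots> \<le> (\<Sum>i\<in>{..n}. gauge_content s 1 (L k ` V i))"
    by (rule gauge_content_finite_UN) auto
  also have "\<dots> \<le> (\<Sum>i\<in>{..n}. ennreal (log_gauge s t))"
  proof (rule sum_mono)
    fix i
    have lip: "dist (L k x) (L k y) \<le> (2 / R) * dist x y" if "x \<in> V i" "y \<in> V i" for x y
      by (rule L_lipschitz_T[OF pos(1) _ that]) (auto simp: V_def)
    note b = bounded_diameter_lipschitz_image[OF V(1) lip]
    have "diameter (L k ` V i) \<le> (2 / R) * diameter (V i)" using pos by (intro b) auto
    also have "\<dots> \<le> (2 / R) * (3 * H)" using V pos by (intro mult_left_mono) auto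
    also have "\<dots> = t" by (simp add: t_def)
    finally show "gauge_content s 1 (L k ` V i) \<le> ennreal (log_gauge s t)"
      using HR s pos by (intro gauge_content_single b) auto
  qed
  also have "\<dots> = ennreal (real (Suc n) * log_gauge s t)" by (simp add: ennreal_mult' ennreal_of_nat_eq_real_of_nat)
  also have "\<dots> \<le> ennreal (24 * (a / 4) powr (-s))"
  proof (rule ennreal_leI)
    have "0 \<le> 3 * R / H" using pos by simp
    then have "real n \<le> 3 * R / H" unfolding n_def by linarith
    moreover have "1 \<le> R / H" using HR pos by simp
    ultimately have "real (Suc n) \<le> 4 * R / H" by simp
    moreover have "log_gauge s t \<le> t * (a / 4) powr (-s)"
    proof -
      have "(a / 4) powr s \<le> ln (1 / t) powr s" using HR s a by (intro powr_mono2) auto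
      then have "t / ln (1 / t) powr s \<le> t / (a / 4) powr s"
        using pos a by (intro divide_left_mono mult_pos_pos) (auto intro: less_le_trans[of _ "(a / 4) powr s"])
      then show ?thesis by (simp add: log_gauge_def powr_minus_divide)
    qed
    moreover have "0 \<le> log_gauge s t" using pos by (simp add: log_gauge_def)
    ultimately have "real (Suc n) * log_gauge s t \<le> (4 * R / H) * (t * (a / 4) powr (-s))"
      using pos by (intro mult_mono) auto
    also have "\<dots> = 24 * (a / 4) powr (-s)" using pos by (simp add: t_def)
    finally show "real (Suc n) * log_gauge s t \<le> 24 * (a / 4) powr (-s)" .
  qed
  finally show ?thesis .
qed

text \<open>At most \<open>32 * R^2\<close> boxes, each of content at most
  \<open>c * (R / 16) powr (-s)\<close>, are pulled back with factor \<open>2 / R\<close>. The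
  assumption \<open>small\<close> turns the total into half of the old bound, and
  \<open>2 / R \<le> 1 / 2\<close> halves the scale.\<close>

lemma content_box_step:
  assumes s: "0 \<le> s" and d: "0 < d" "d \<le> 1"
    and IH: "\<And>a b. A \<le> a \<Longrightarrow> gauge_content s d (T \<inter> unit_box a b) \<le> ennreal (c * (a / 4) powr (-s))"
    and c: "0 \<le> c" and R4: "4 \<le> exp (a - B)" and RA: "A \<le> exp (a - B) / 4"
    and small: "64 * exp (a - B) * (exp (a - B) / 16) powr (-s) \<le> 1/2 * (a / 4) powr (-s)"
  shows "gauge_content s (d / 2) (T \<inter> unit_box a b) \<le> ennreal (c / 2 * (a / 4) powr (-s))"
proof -
  define R where "R = exp (a - B)"
  have R: "4 \<le> R" using R4 by (simp add: R_def)
  define W where "W = {w \<in> T. R \<le> norm w \<and> norm w \<le> 3 * R}"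
  obtain k where k0: "T \<inter> unit_box a b \<subseteq> L k ` {w \<in> T. exp (a - B) \<le> norm w \<and> norm w \<le> 3 * exp (a - B) \<and> \<bar>Im w\<bar> \<le> exp ((a + 1) / 2)}"
    by (rule box_pullback)
  have k: "T \<inter> unit_box a b \<subseteq> L k ` W"
    by (rule order_trans[OF k0 image_mono]) (auto simp: W_def R_def)
  define I where "I = {\<lfloor>R / 2\<rfloor>..\<lfloor>3 * R\<rfloor>}"
  define J where "J = {\<lfloor>- 3 * R\<rfloor>..\<lfloor>3 * R\<rfloor>}"
  have WQ: "W \<subseteq> (\<Union>p\<in>I \<times> J. T \<inter> unit_box (of_int (fst p)) (of_int (snd p)))"
  proof
    fix w assume w: "w \<in> W"
    have "R / 2 \<le> Re w" using w by (intro T_Re_ge) (auto simp: W_def)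
    moreover have "Re w \<le> 3 * R" using w complex_Re_le_cmod[of w] by (auto simp: W_def)
    ultimately have "\<lfloor>Re w\<rfloor> \<in> I" by (auto simp: I_def intro: floor_mono)
    moreover have "\<bar>Im w\<bar> \<le> 3 * R" using w abs_Im_le_cmod[of w] by (auto simp: W_def)
    then have "- 3 * R \<le> Im w" "Im w \<le> 3 * R" by linarith+
    then have "\<lfloor>Im w\<rfloor> \<in> J" unfolding J_def by (auto intro!: floor_mono simp del: mult_minus_left)
    moreover have "w \<in> T \<inter> unit_box (of_int \<lfloor>Re w\<rfloor>) (of_int \<lfloor>Im w\<rfloor>)"
      using w unfolding unit_box_def W_def by simp
    ultimately show "w \<in> (\<Union>p\<in>I \<times> J. T \<inter> unit_box (of_int (fst p)) (of_int (snd p)))"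
      by (intro UN_I[of "(\<lfloor>Re w\<rfloor>, \<lfloor>Im w\<rfloor>)"]) auto
  qed
  define e where "e = c * (R / 16) powr (-s)"
  have e: "0 \<le> e" using c by (simp add: e_def)
  have "gauge_content s d W \<le> gauge_content s d (\<Union>p\<in>I \<times> J. T \<inter> unit_box (of_int (fst p)) (of_int (snd p)))"
    by (rule gauge_content_mono[OF WQ]) simp
  also have "\<dots> \<le> (\<Sum>p\<in>I \<times> J. gauge_content s d (T \<inter> unit_box (of_int (fst p)) (of_int (snd p))))"
    by (rule gauge_content_finite_UN) (auto simp: I_def J_def d)
  also have "\<dots> \<le> (\<Sum>p\<in>I \<times> J. ennreal e)"
  proof (rule sum_mono)
    fix p assume "p \<in> I \<times> J"
    then have "fst p \<in> I" by auto
    then have "\<lfloor>R / 2\<rfloor> \<le> fst p" by (simp add: I_def)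
    \<comment> \<open>Rounding \<open>R / 2\<close> down loses less than 1, which is at most
      \<open>R / 4\<close> because \<open>R \<ge> 4\<close>.\<close>
    then have i: "R / 4 \<le> of_int (fst p)" using R by linarith
    have "gauge_content s d (T \<inter> unit_box (of_int (fst p)) (of_int (snd p))) \<le> ennreal (c * (of_int (fst p) / 4) powr (-s))"
      using i RA by (intro IH) (simp add: R_def)
    also have "\<dots> \<le> ennreal e"
      unfolding e_def using i R s c by (intro ennreal_leI mult_left_mono powr_mono2') auto
    finally show "gauge_content s d (T \<inter> unit_box (of_int (fst p)) (of_int (snd p))) \<le> ennreal e" .
  qed
  also have "\<dots> = ennreal (real (card (I \<times> J)) * e)"
    using e by (simp add: ennreal_mult' ennreal_of_nat_eq_real_of_nat)
  also have "\<dots> \<le> ennreal (32 * R * R * e)"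
  proof (intro ennreal_leI mult_right_mono e)
    have "\<lfloor>3 * R\<rfloor> + 1 - \<lfloor>R / 2\<rfloor> \<le> 4 * R" "\<lfloor>3 * R\<rfloor> + 1 - \<lfloor>- 3 * R\<rfloor> \<le> 8 * R" using R by linarith+
    then have "real (card I) \<le> 4 * R" "real (card J) \<le> 8 * R" using R unfolding I_def J_def by auto
    then have "real (card I) * real (card J) \<le> (4 * R) * (8 * R)" using R by (intro mult_mono) auto
    then show "real (card (I \<times> J)) \<le> 32 * R * R" by (simp add: card_cartesian_product)
  qed
  finally have cW: "gauge_content s d W \<le> ennreal (32 * R * R * e)" .
  have "gauge_content s (d / 2) (T \<inter> unit_box a b) \<le> gauge_content s (2 / R * d) (L k ` W)"
    using k R d by (intro gauge_content_mono) (auto simp: field_simps)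
  also have "\<dots> \<le> ennreal (2 / R) * gauge_content s d W"
  proof (rule gauge_content_lipschitz_image)
    show "dist (L k x) (L k y) \<le> 2 / R * dist x y" if "x \<in> W" "y \<in> W" for x y
      by (rule L_lipschitz_T[OF _ _ that]) (use R in \<open>auto simp: W_def\<close>)
  qed (use R d s in auto)
  also have "\<dots> \<le> ennreal (2 / R) * ennreal (32 * R * R * e)" by (rule mult_left_mono[OF cW]) simp
  also have "\<dots> = ennreal (2 / R * (32 * R * R * e))" using R e by (intro ennreal_mult[symmetric]) auto
  also have "\<dots> \<le> ennreal (c / 2 * (a / 4) powr (-s))"
  proof (rule ennreal_leI)
    have "2 / R * (32 * R * R * e) = c * (64 * R * (R / 16) powr (-s))" using R by (simp add: e_def)
    also have "\<dots> \<le> c * (1/2 * (a / 4) powr (-s))" using small c by (intro mult_left_mono) (auto simp: R_def)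
    finally show "2 / R * (32 * R * R * e) \<le> c / 2 * (a / 4) powr (-s)" by simp
  qed
  finally show ?thesis .
qed

lemma content_box_eq_0:
  assumes "1 < s"
  shows "\<exists>A. \<forall>a\<ge>A. \<forall>b. \<forall>\<delta>>0. gauge_content s \<delta> (T \<inter> unit_box a b) = 0"
proof -
  \<comment> \<open>The last condition is where \<open>s > 1\<close> enters: its left side decays
    exponentially in \<open>a\<close>.\<close>
  have "eventually (\<lambda>a. 0 < a \<and> exp ((a + 1) / 2) \<le> exp (a - B) \<and> 6 * exp ((a + 1) / 2) / exp (a - B) < 1
      \<and> a / 4 \<le> ln (1 / (6 * exp ((a + 1) / 2) / exp (a - B)))
      \<and> 4 \<le> exp (a - B) \<and> a \<le> exp (a - B) / 4
      \<and> 64 * exp (a - B) * (exp (a - B) / 16) powr (-s) \<le> 1/2 * (a / 4) powr (-s)) at_top"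
    using assms by (intro eventually_conj; real_asymp)
  then obtain A where A: "\<And>a. A \<le> a \<Longrightarrow> 0 < a \<and> exp ((a + 1) / 2) \<le> exp (a - B) \<and> 6 * exp ((a + 1) / 2) / exp (a - B) < 1
      \<and> a / 4 \<le> ln (1 / (6 * exp ((a + 1) / 2) / exp (a - B)))
      \<and> 4 \<le> exp (a - B) \<and> a \<le> exp (a - B) / 4
      \<and> 64 * exp (a - B) * (exp (a - B) / 16) powr (-s) \<le> 1/2 * (a / 4) powr (-s)"
    unfolding eventually_at_top_linorder by blast
  have P: "gauge_content s ((1/2) ^ n) (T \<inter> unit_box a b) \<le> ennreal (24 * (1/2) ^ n * (a / 4) powr (-s))" if "A \<le> a" for n a b
    using that
  proof (induction n arbitrary: a b)
    case 0
    then show ?case using content_box_base[of s a b] A[OF 0] assms by simp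
  next
    case (Suc n)
    \<comment> \<open>The boxes met after one step again lie beyond the threshold
      \<open>A\<close>.\<close>
    have "A \<le> exp (a - B) / 4" using A[OF Suc.prems] Suc.prems by linarith
    then have "gauge_content s ((1/2) ^ n / 2) (T \<inter> unit_box a b) \<le> ennreal (24 * (1/2) ^ n / 2 * (a / 4) powr (-s))"
      using A[OF Suc.prems] assms by (intro content_box_step[where A = A] Suc.IH) (auto simp: power_le_one)
    then show ?case by simp
  qed
  have "gauge_content s \<delta> (T \<inter> unit_box a b) = 0" if "A \<le> a" "0 < \<delta>" for a b \<delta>
  proof -
    have "gauge_content s \<delta> (T \<inter> unit_box a b) \<le> 0"
    proof (rule ennreal_le_epsilon)
      fix e :: real assume "0 < e"
      have "(\<lambda>n. (1/2) ^ n) \<longlonglongrightarrow> (0::real)" by (rule LIMSEQ_power_zero) simp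
      moreover have "(\<lambda>n. 24 * (1/2) ^ n * (a / 4) powr (-s)) \<longlonglongrightarrow> 24 * 0 * (a / 4) powr (-s)"
        by (intro tendsto_intros LIMSEQ_power_zero) simp
      then have "(\<lambda>n. 24 * (1/2) ^ n * (a / 4) powr (-s)) \<longlonglongrightarrow> 0" by simp
      ultimately have "eventually (\<lambda>n. (1/2) ^ n < \<delta> \<and> 24 * (1/2) ^ n * (a / 4) powr (-s) < e) sequentially"
        using that(2) \<open>0 < e\<close> by (intro eventually_conj order_tendstoD(2))
      then obtain n where n: "(1/2) ^ n < \<delta>" "24 * (1/2) ^ n * (a / 4) powr (-s) < e"
        by (auto simp: eventually_sequentially)
      have "gauge_content s \<delta> (T \<inter> unit_box a b) \<le> gauge_content s ((1/2) ^ n) (T \<inter> unit_box a b)"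
        using n by (intro gauge_content_mono) auto
      also have "\<dots> \<le> ennreal (24 * (1/2) ^ n * (a / 4) powr (-s))" by (rule P[OF that(1)])
      also have "\<dots> \<le> ennreal e" using n by (intro ennreal_leI) simp
      finally show "gauge_content s \<delta> (T \<inter> unit_box a b) \<le> 0 + ennreal e" by simp
    qed
    then show ?thesis by simp
  qed
  then show ?thesis by blast
qed

text \<open>Countably many integer boxes cover the part of \<open>T\<close> far to the right, and
  preimages under \<open>E\<close> are countable unions of contracted copies. The \<open>+ 1\<close>
  allows for rounding the real part down.\<close>

lemma content_preimage_T_eq_0:
  assumes zero: "\<And>a b. A \<le> a \<Longrightarrow> gauge_content s \<delta> (T \<inter> unit_box a b) = 0" and \<delta>: "0 < \<delta>" "\<delta> \<le> 1" and s: "0 \<le> s"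
  shows "gauge_content s \<delta> {z \<in> X. (E ^^ n) z \<in> T \<and> A + 1 \<le> Re ((E ^^ n) z)} = 0"
proof (induction n)
  case 0
  have sub: "{z \<in> X. z \<in> T \<and> A + 1 \<le> Re z} \<subseteq> (\<Union>p\<in>{p. A \<le> real_of_int (fst p)}. T \<inter> unit_box (of_int (fst p)) (of_int (snd p)))"
  proof
    fix z assume "z \<in> {z \<in> X. z \<in> T \<and> A + 1 \<le> Re z}"
    then have z: "z \<in> T" "A + 1 \<le> Re z" by auto
    then have "A \<le> real_of_int \<lfloor>Re z\<rfloor>" by linarith
    moreover have "z \<in> T \<inter> unit_box (of_int \<lfloor>Re z\<rfloor>) (of_int \<lfloor>Im z\<rfloor>)"
      using z unfolding unit_box_def by simp
    ultimately show "z \<in> (\<Union>p\<in>{p. A \<le> real_of_int (fst p)}. T \<inter> unit_box (of_int (fst p)) (of_int (snd p)))"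
      by (intro UN_I[of "(\<lfloor>Re z\<rfloor>, \<lfloor>Im z\<rfloor>)"]) auto
  qed
  have "gauge_content s \<delta> (\<Union>p\<in>{p. A \<le> real_of_int (fst p)}. T \<inter> unit_box (of_int (fst p)) (of_int (snd p))) = 0"
    by (rule gauge_content_countable_UN_eq_0) (use \<delta> zero in auto)
  then show ?case using gauge_content_mono[OF sub, of \<delta> \<delta> s] by simp
next
  case (Suc n)
  define Z where "Z = {z \<in> X. (E ^^ n) z \<in> T \<and> A + 1 \<le> Re ((E ^^ n) z)}"
  have sub: "{z \<in> X. (E ^^ Suc n) z \<in> T \<and> A + 1 \<le> Re ((E ^^ Suc n) z)} \<subseteq> (\<Union>k\<in>UNIV. L k ` Z)"
  proof
    fix z assume z: "z \<in> {z \<in> X. (E ^^ Suc n) z \<in> T \<and> A + 1 \<le> Re ((E ^^ Suc n) z)}"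
    then have "E z \<in> Z" unfolding Z_def funpow_Suc_right comp_apply using X_E by simp
    moreover have "z = L (itin z 0) (E z)" using z by (intro X_eq_L) simp
    ultimately show "z \<in> (\<Union>k\<in>UNIV. L k ` Z)" by blast
  qed
  have "gauge_content s \<delta> (L k ` Z) = 0" for k
  proof -
    have "gauge_content s \<delta> (L k ` Z) \<le> gauge_content s (1 / B * \<delta>) (L k ` Z)"
      using B_gt_1 \<delta> by (intro gauge_content_mono) (auto simp: field_simps)
    also have "\<dots> \<le> ennreal (1 / B) * gauge_content s \<delta> Z"
      using B_gt_1 \<delta> s by (intro gauge_content_lipschitz_image L_lipschitz) (auto simp: Z_def X_Re_ge0)
    also have "\<dots> = 0" using Suc by (simp add: Z_def)
    finally show ?thesis by simp
  qed
  then have "gauge_content s \<delta> (\<Union>k\<in>UNIV. L k ` Z) = 0"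
    by (intro gauge_content_countable_UN_eq_0 \<delta>) auto
  then show ?case using gauge_content_mono[OF sub, of \<delta> \<delta> s] by (metis le_zero_eq order_refl)
qed

end

theorem theorem1p1:
  fixes lam s :: real
  assumes "0 < lam" and "lam < 1 / exp 1" and "s > 1"
  shows "hausdorff_gauge (\<lambda>t. t / (ln (1 / t)) powr s)
           (julia_set (expmap lam) - endpoints (expmap lam)) = 0"
proof -
  interpret exp_family lam by unfold_locales fact+
  obtain A where A: "\<And>a b \<delta>. A \<le> a \<Longrightarrow> 0 < \<delta> \<Longrightarrow> gauge_content s \<delta> (T \<inter> unit_box a b) = 0"
    using content_box_eq_0[OF assms(3)] by blast
  define Z where "Z n = {z \<in> X. (E ^^ n) z \<in> T \<and> A + 1 \<le> Re ((E ^^ n) z)}" for n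
  have sub: "julia_set E - endpoints E \<subseteq> (\<Union>n\<in>UNIV. Z n)"
  proof
    fix z assume z: "z \<in> julia_set E - endpoints E"
    then have "z \<in> X" by (simp add: julia_set_eq)
    moreover obtain w where "w \<in> X" "itin w = itin z" "below w z"
      using minimal_imp_endpoint[of z] z \<open>z \<in> X\<close> by blast
    ultimately obtain n where "(E ^^ n) z \<in> T \<and> A + 1 \<le> Re ((E ^^ n) z)"
      using not_minimal_imp_eventually_T[of z w "A + 1"] by auto
    then show "z \<in> (\<Union>n\<in>UNIV. Z n)" using \<open>z \<in> X\<close> by (auto simp: Z_def)
  qed
  have "gauge_content s \<delta> (julia_set E - endpoints E) = 0" if "0 < \<delta>" for \<delta>
  proof -
    \<comment> \<open>Content only increases when the scale shrinks, so passing to a scale at most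
      1, where the gauge is controlled, is safe.\<close>
    have "gauge_content s (min \<delta> 1) (Z n) = 0" for n
      unfolding Z_def by (rule content_preimage_T_eq_0) (use A that assms in auto)
    then have "gauge_content s (min \<delta> 1) (\<Union>n\<in>UNIV. Z n) = 0"
      using that by (intro gauge_content_countable_UN_eq_0) auto
    then show ?thesis using gauge_content_mono[OF sub, of "min \<delta> 1" \<delta> s] by simp
  qed
  then show ?thesis unfolding hausdorff_gauge_log_gauge by simp
qed

end
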